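(* Suppose that the standing assumptions (SA1), (SA2), (SA3) and Assumption 2 of the context hold. Then, for any $i\in\mathbb{Z}_{\ge0}$, any $x\in\mathbb{R}^{n_x}$, any solution $\phi^i(\cdot,x)$, initialized at $x$, of the difference inclusion $x(k+1)\in F_r^i(x(k)):=f(x(k),H_r^{\star,i}(x(k)))$, and any $k\in\mathbb{Z}_{\ge0}$, $$\sigma(\phi^i(k,x))\le\beta(\sigma(x),k),$$ where $\beta\in\mathcal{KL}$ is given by $\beta(s,k)=\underline\alpha_Y^{-1}\circ(\mathbb{I}-\widetilde\alpha_Y)^{(k)}\circ\overline\alpha_Y(s)$, with $\underline\alpha_Y,\overline\alpha_Y,\widetilde\alpha_Y$ defined in the context (in particular $\beta$ does not depend on $i$).
   Context: Notation. $\mathbb{R}_{\ge0}=[0,\infty)$, $\mathbb{Z}_{\ge0}=\{0,1,\dots\}$; $\mathbb{B}$ is the closed unit ball of $\mathbb{R}^{n_x}$. $\mathbb{I}$ is the identity on $\mathbb{R}_{\ge0}$; $g^{(k)}$ is the $k$-fold composition of $g$ with itself, $g^{(0)}=\mathbb{I}$. $\mathcal{K}_\infty$: continuous, strictly increasing, unbounded functions $\mathbb{R}_{\ge0}\to\mathbb{R}_{\ge0}$ that are zero at zero. $\mathcal{KL}$: functions $\beta(s,k)\ge0$ of $s\in\mathbb{R}_{\ge0}$ and $k$ (here $k\in\mathbb{Z}_{\ge0}$), nondecreasing in $s$ with $\lim_{s\to0^+}\beta(s,k)=0$ for each $k$, and nonincreasing in $k$ with $\lim_{k\to\infty}\beta(s,k)=0$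 for each $s$. A selection of a set-valued map $S$ is a single-valued $s$ with $s(x)\in S(x)$ for all $x\in\operatorname{dom}S$; one writes $s\in S$. A set-valued map $S$ is outer semicontinuous if $x_n\to x$, $u_n\in S(x_n)$, $u_n\to u$ imply $u\in S(x)$. For a set $A$, $S(A)=\bigcup_{a\in A}S(a)$. A function $\ell(x,u)$ is level-bounded in $u$, locally uniform in $x$, if for each $x\in\mathbb{R}^{n_x}$ and $\alpha\in\mathbb{R}$ there are a neighborhood $\mathcal{S}$ of $x$ and a bounded set $B\subset\mathbb{R}^{n_u}$ such that $\{u:\ell(z,u)\le\alpha\}\subset B$ for all $z\in\mathcal{S}$. Plant and cost. $x(k+1)=f(x(k),u(k))$ with $x\in\mathbb{R}^{n_x}$, $u\in\mathcal{U}(x)\subseteq\mathbb{R}^{n_u}$, $\mathcal{U}(x)\neq\emptyset$ for every $x$; $\mathcal{W}=\{(x,u):u\in\mathcal{U}(x)\}$. The stage cost is $\ell:\mathbb{R}^{n_x}\times\mathbb{R}^{n_u}\to\mathbb{R}_{\ge0}$. For an admissible infinite input sequence $\mathbf{u}$, $J(x,\mathbf{u})=\sum_{k=0}^\infty\ell(x(k),u(k))$ along the resulting solution from $x(0)=x$. For a policy $h\in\mathcal{U}$, $\phi(k,x,h)$ is the closed-loop solution from $x$ and $J(x,h)=\sum_{k=0}^\infty\ell(\phi(k,x,h),h(\phi(k,x,h)))$. $V^\star(x)=\min_{\mathbf{u}}J(x,\mathbf{u})$. Standing assumptions. $\sigma:\mathbb{R}^{n_x}\to\mathbb{R}_{\ge0}$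 is continuous, and $h^0\in\mathcal{U}$ is a given initial policy. (SA1) For every $x$ there is an admissible input sequence $\mathbf{u}^\star(x)$ attaining the minimum $V^\star(x)=J(x,\mathbf{u}^\star(x))<+\infty$. (SA2) There exist a continuous $W:\mathbb{R}^{n_x}\to\mathbb{R}_{\ge0}$, $\alpha_W,\chi_W\in\mathcal{K}_\infty$ and $\overline\alpha_W:\mathbb{R}_{\ge0}\to\mathbb{R}_{\ge0}$ continuous, nondecreasing and zero at zero such that for all $(x,u)\in\mathcal{W}$: $W(x)\le\overline\alpha_W(\sigma(x))$ and $W(f(x,u))-W(x)\le-\alpha_W(\sigma(x))+\chi_W(\ell(x,u))$. (SA3) There exists $\overline\alpha_V\in\mathcal{K}_\infty$ with $J(x,h^0)\le\overline\alpha_V(\sigma(x))$ for all $x\in\mathbb{R}^{n_x}$. Algorithm PI$^+$. $V_r^0:=J(\cdot,h^0)$, $H^0:=H_r^0:=H_r^{\star,0}:=\{h^0\}$. For $i\in\mathbb{Z}_{\ge0}$ and all $x$: $H^{i+1}(x):=\operatorname{argmin}_{u\in\mathcal{U}(x)}\{\ell(x,u)+V_r^i(f(x,u))\}$; $H_r^{i+1}(x):=\bigcap_{\delta>0}\overline{H^{i+1}(x+\delta\mathbb{B})}$; $V_r^{i+1}(x):=\min_{h\in H_r^{i+1}}J(x,h)$ (minimum over selections $h$ of $H_r^{i+1}$); $H_r^{\star,i+1}(x):=\operatorname{argmin}_{u\in H_r^{i+1}(x)}\{\ell(x,u)+V_r^{i+1}(f(x,u))\}$. Assumption 2. (i) $f$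 and $\ell$ are continuous on $\mathbb{R}^{n_x}\times\mathbb{R}^{n_u}$. (ii) $\ell$ is level-bounded in $u$, locally uniform in $x$. (iii) $\mathcal{U}$ is outer semicontinuous on $\mathbb{R}^{n_x}$. (iv) $V_r^0=J(\cdot,h^0)$ is lower semicontinuous on $\mathbb{R}^{n_x}$. (v) For all $\Delta>0$, $\{x:\sigma(x)\le\Delta\}$ is compact. Functions. General case: $q_V(s)=2\chi_W(2s)$; $q_W=\tfrac12[\chi_W+(\overline\alpha_W+\mathbb{I})\circ\alpha_W^{-1}(2\chi_W)]^{-1}$ (one half of the inverse function); $\rho_V(s)=\int_0^sq_V(\tau)d\tau$; $\rho_W(s)=\int_0^sq_W(\tau)d\tau$; $\alpha_Y=q_W(\tfrac14\alpha_W)\,\tfrac14\alpha_W$; $\overline\alpha_Y=\rho_V\circ\overline\alpha_V+\rho_W\circ\overline\alpha_W$; $\underline\alpha_Y=\min\{\rho_V\circ\chi_W^{-1}(\tfrac12\alpha_W),\rho_W(\tfrac12\alpha_W)\}$; $\widetilde\alpha_Y=\alpha_Y\circ\overline\alpha_Y^{-1}$. When $\chi_W\le\mathbb{I}$, instead: $\alpha_Y=\alpha_W$, $\overline\alpha_Y=\overline\alpha_V+\overline\alpha_W$, $\underline\alpha_Y=\alpha_W$, $\widetilde\alpha_Y=\alpha_Y\circ\overline\alpha_Y^{-1}$. Convention: $\mathbb{I}-\widetilde\alpha_Y$ is assumed non-decreasing; if it is not, $(\mathbb{I}-\widetilde\alpha_Y)^{(k)}$ in the formula of $\beta$ is replaced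 by $s\mapsto\max_{\hat s\in[0,s]}(\mathbb{I}-\widetilde\alpha_Y)^{(k)}(\hat s)$. *)

theory Defs
  imports "HOL-Analysis.Analysis"
begin

text \<open>Comparison functions. A function on $[0,\infty)$ is a total function on the reals of which
  only the restriction to \<^term>\<open>{0..}\<close> matters; inverses are therefore taken with
  \<^term>\<open>inv_into {0..}\<close>.\<close>

definition class_K_inf :: "(real \<Rightarrow> real) \<Rightarrow> bool" where
  "class_K_inf a \<longleftrightarrow> a ` {0..} \<subseteq> {0..} \<and> continuous_on {0..} a \<and> strict_mono_on {0..} a
     \<and> a 0 = 0 \<and> \<not> bdd_above (a ` {0..})"

definition class_KL :: "(real \<Rightarrow> nat \<Rightarrow> real) \<Rightarrow> bool" where
  "class_KL b \<longleftrightarrow>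
     (\<forall>s\<ge>0. \<forall>k. b s k \<ge> 0)
   \<and> (\<forall>k. mono_on {0..} (\<lambda>s. b s k) \<and> ((\<lambda>s. b s k) \<longlongrightarrow> 0) (at_right 0))
   \<and> (\<forall>s\<ge>0. antimono (b s) \<and> b s \<longlonglongrightarrow> 0)"

definition inv_nn :: "(real \<Rightarrow> real) \<Rightarrow> real \<Rightarrow> real" where
  "inv_nn a = inv_into {0..} a"


definition osc :: "('a::topological_space \<Rightarrow> 'b::topological_space set) \<Rightarrow> bool" where
  "osc S \<longleftrightarrow> (\<forall>xs us x u. xs \<longlonglongrightarrow> x \<and> (\<forall>n. us n \<in> S (xs n)) \<and> us \<longlonglongrightarrow> u \<longrightarrow> u \<in> S x)"

definition lsc :: "('a::t2_space \<Rightarrow> ennreal) \<Rightarrow> bool" where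
  "lsc V \<longleftrightarrow> (\<forall>x. V x \<le> Liminf (at x) V)"

definition level_bounded_loc_unif :: "('a::topological_space \<Rightarrow> 'b::metric_space \<Rightarrow> real) \<Rightarrow> bool" where
  "level_bounded_loc_unif l \<longleftrightarrow>
     (\<forall>x \<alpha>. \<exists>S B. open S \<and> x \<in> S \<and> bounded B \<and> (\<forall>z\<in>S. {u. l z u \<le> \<alpha>} \<subseteq> B))"

definition selection :: "('a \<Rightarrow> 'b set) \<Rightarrow> ('a \<Rightarrow> 'b) \<Rightarrow> bool" where
  "selection S s \<longleftrightarrow> (\<forall>x. S x \<noteq> {} \<longrightarrow> s x \<in> S x)"


primrec trajectory :: "('x \<Rightarrow> 'u \<Rightarrow> 'x) \<Rightarrow> 'x \<Rightarrow> (nat \<Rightarrow> 'u) \<Rightarrow> nat \<Rightarrow> 'x" where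
  "trajectory f x us 0 = x"
| "trajectory f x us (Suc k) = f (trajectory f x us k) (us k)"

definition admissible :: "('x \<Rightarrow> 'u \<Rightarrow> 'x) \<Rightarrow> ('x \<Rightarrow> 'u set) \<Rightarrow> 'x \<Rightarrow> (nat \<Rightarrow> 'u) \<Rightarrow> bool" where
  "admissible f U x us \<longleftrightarrow> (\<forall>k. us k \<in> U (trajectory f x us k))"

definition cost_seq :: "('x \<Rightarrow> 'u \<Rightarrow> 'x) \<Rightarrow> ('x \<Rightarrow> 'u \<Rightarrow> real) \<Rightarrow> 'x \<Rightarrow> (nat \<Rightarrow> 'u) \<Rightarrow> ennreal" where
  "cost_seq f l x us = (\<Sum>k. ennreal (l (trajectory f x us k) (us k)))"

definition opt_value ::
  "('x \<Rightarrow> 'u \<Rightarrow> 'x) \<Rightarrow> ('x \<Rightarrow> 'u \<Rightarrow> real) \<Rightarrow> ('x \<Rightarrow> 'u set) \<Rightarrow> 'x \<Rightarrow> ennreal" where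
  "opt_value f l U x = (INF us\<in>{us. admissible f U x us}. cost_seq f l x us)"

definition closed_loop :: "('x \<Rightarrow> 'u \<Rightarrow> 'x) \<Rightarrow> nat \<Rightarrow> 'x \<Rightarrow> ('x \<Rightarrow> 'u) \<Rightarrow> 'x" where
  "closed_loop f k x h = ((\<lambda>y. f y (h y)) ^^ k) x"

definition cost :: "('x \<Rightarrow> 'u \<Rightarrow> 'x) \<Rightarrow> ('x \<Rightarrow> 'u \<Rightarrow> real) \<Rightarrow> 'x \<Rightarrow> ('x \<Rightarrow> 'u) \<Rightarrow> ennreal" where
  "cost f l x h = (\<Sum>k. ennreal (l (closed_loop f k x h) (h (closed_loop f k x h))))"


text \<open>Policy iteration with outer semicontinuous regularization. The one-step operators
  \<open>argmin_map\<close> (argmin of the one-step cost plus \<open>V\<close> over the values of a set-valued map) and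
  \<open>regularize\<close> are separated out so that the value functions can be defined by primitive
  recursion; \<open>PI_H\<close>, \<open>PI_Hr\<close> and \<open>PI_Hstar\<close> are then the maps $H^i$, $H_r^i$ and
  $H_r^{\star,i}$ of the iteration.\<close>

definition argmin_map ::
  "('x \<Rightarrow> 'u \<Rightarrow> 'x) \<Rightarrow> ('x \<Rightarrow> 'u \<Rightarrow> real) \<Rightarrow> ('x \<Rightarrow> 'u set) \<Rightarrow> ('x \<Rightarrow> ennreal) \<Rightarrow> 'x \<Rightarrow> 'u set" where
  "argmin_map f l S V x =
     {u. is_arg_min (\<lambda>u. ennreal (l x u) + V (f x u)) (\<lambda>u. u \<in> S x) u}"

definition regularize ::
  "('x::metric_space \<Rightarrow> 'u::topological_space set) \<Rightarrow> 'x \<Rightarrow> 'u set" where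
  "regularize S x = (\<Inter>\<delta>\<in>{0<..}. closure (\<Union>y\<in>cball x \<delta>. S y))"

text \<open>The minimum over selections is written as an infimum in \<^typ>\<open>ennreal\<close>; the two agree
  whenever the minimum is attained.\<close>

primrec PI_V ::
  "('x::metric_space \<Rightarrow> 'u::topological_space \<Rightarrow> 'x) \<Rightarrow> ('x \<Rightarrow> 'u \<Rightarrow> real) \<Rightarrow> ('x \<Rightarrow> 'u set)
    \<Rightarrow> ('x \<Rightarrow> 'u) \<Rightarrow> nat \<Rightarrow> 'x \<Rightarrow> ennreal" where
  "PI_V f l U h0 0 = (\<lambda>x. cost f l x h0)"
| "PI_V f l U h0 (Suc i) =
     (\<lambda>x. INF h\<in>{h. selection (regularize (argmin_map f l U (PI_V f l U h0 i))) h}. cost f l x h)"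

primrec PI_H ::
  "('x::metric_space \<Rightarrow> 'u::topological_space \<Rightarrow> 'x) \<Rightarrow> ('x \<Rightarrow> 'u \<Rightarrow> real) \<Rightarrow> ('x \<Rightarrow> 'u set)
    \<Rightarrow> ('x \<Rightarrow> 'u) \<Rightarrow> nat \<Rightarrow> 'x \<Rightarrow> 'u set" where
  "PI_H f l U h0 0 = (\<lambda>x. {h0 x})"
| "PI_H f l U h0 (Suc i) = argmin_map f l U (PI_V f l U h0 i)"

primrec PI_Hr ::
  "('x::metric_space \<Rightarrow> 'u::topological_space \<Rightarrow> 'x) \<Rightarrow> ('x \<Rightarrow> 'u \<Rightarrow> real) \<Rightarrow> ('x \<Rightarrow> 'u set)
    \<Rightarrow> ('x \<Rightarrow> 'u) \<Rightarrow> nat \<Rightarrow> 'x \<Rightarrow> 'u set" where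
  "PI_Hr f l U h0 0 = (\<lambda>x. {h0 x})"
| "PI_Hr f l U h0 (Suc i) = regularize (PI_H f l U h0 (Suc i))"

primrec PI_Hstar ::
  "('x::metric_space \<Rightarrow> 'u::topological_space \<Rightarrow> 'x) \<Rightarrow> ('x \<Rightarrow> 'u \<Rightarrow> real) \<Rightarrow> ('x \<Rightarrow> 'u set)
    \<Rightarrow> ('x \<Rightarrow> 'u) \<Rightarrow> nat \<Rightarrow> 'x \<Rightarrow> 'u set" where
  "PI_Hstar f l U h0 0 = (\<lambda>x. {h0 x})"
| "PI_Hstar f l U h0 (Suc i) = argmin_map f l (PI_Hr f l U h0 (Suc i)) (PI_V f l U h0 (Suc i))"

lemma PI_V_Suc_eq:
  "PI_V f l U h0 (Suc i) x = (INF h\<in>{h. selection (PI_Hr f l U h0 (Suc i)) h}. cost f l x h)"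
  by simp

definition PI_F ::
  "('x::metric_space \<Rightarrow> 'u::topological_space \<Rightarrow> 'x) \<Rightarrow> ('x \<Rightarrow> 'u \<Rightarrow> real) \<Rightarrow> ('x \<Rightarrow> 'u set)
    \<Rightarrow> ('x \<Rightarrow> 'u) \<Rightarrow> nat \<Rightarrow> 'x \<Rightarrow> 'x set" where
  "PI_F f l U h0 i x = f x ` PI_Hstar f l U h0 i x"

definition inclusion_solution :: "('x \<Rightarrow> 'x set) \<Rightarrow> 'x \<Rightarrow> (nat \<Rightarrow> 'x) \<Rightarrow> bool" where
  "inclusion_solution F x \<phi> \<longleftrightarrow> \<phi> 0 = x \<and> (\<forall>k. \<phi> (Suc k) \<in> F (\<phi> k))"


text \<open>The functions entering the bound. Arguments: \<open>aW\<close>, \<open>cW\<close>, \<open>bW\<close>, \<open>bV\<close> stand for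
  $\alpha_W$, $\chi_W$, $\overline\alpha_W$, $\overline\alpha_V$. The formulas simplify when
  $\chi_W$ is dominated by the identity.\<close>

definition small_gain :: "(real \<Rightarrow> real) \<Rightarrow> bool" where
  "small_gain cW \<longleftrightarrow> (\<forall>s\<ge>0. cW s \<le> s)"

definition q_V :: "(real \<Rightarrow> real) \<Rightarrow> real \<Rightarrow> real" where
  "q_V cW s = 2 * cW (2 * s)"

definition q_W :: "(real \<Rightarrow> real) \<Rightarrow> (real \<Rightarrow> real) \<Rightarrow> (real \<Rightarrow> real) \<Rightarrow> real \<Rightarrow> real" where
  "q_W aW cW bW s =
     1/2 * inv_nn (\<lambda>t. cW t + (bW (inv_nn aW (2 * cW t)) + inv_nn aW (2 * cW t))) s"

definition rho_V :: "(real \<Rightarrow> real) \<Rightarrow> real \<Rightarrow> real" where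
  "rho_V cW s = integral {0..s} (q_V cW)"

definition rho_W :: "(real \<Rightarrow> real) \<Rightarrow> (real \<Rightarrow> real) \<Rightarrow> (real \<Rightarrow> real) \<Rightarrow> real \<Rightarrow> real" where
  "rho_W aW cW bW s = integral {0..s} (q_W aW cW bW)"

definition alpha_Y :: "(real \<Rightarrow> real) \<Rightarrow> (real \<Rightarrow> real) \<Rightarrow> (real \<Rightarrow> real) \<Rightarrow> real \<Rightarrow> real" where
  "alpha_Y aW cW bW s =
     (if small_gain cW then aW s else q_W aW cW bW (1/4 * aW s) * (1/4 * aW s))"

definition alpha_Y_upper ::
  "(real \<Rightarrow> real) \<Rightarrow> (real \<Rightarrow> real) \<Rightarrow> (real \<Rightarrow> real) \<Rightarrow> (real \<Rightarrow> real) \<Rightarrow> real \<Rightarrow> real" where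
  "alpha_Y_upper aW cW bW bV s =
     (if small_gain cW then bV s + bW s else rho_V cW (bV s) + rho_W aW cW bW (bW s))"

definition alpha_Y_lower :: "(real \<Rightarrow> real) \<Rightarrow> (real \<Rightarrow> real) \<Rightarrow> (real \<Rightarrow> real) \<Rightarrow> real \<Rightarrow> real" where
  "alpha_Y_lower aW cW bW s =
     (if small_gain cW then aW s
      else min (rho_V cW (inv_nn cW (1/2 * aW s))) (rho_W aW cW bW (1/2 * aW s)))"

definition alpha_Y_tilde ::
  "(real \<Rightarrow> real) \<Rightarrow> (real \<Rightarrow> real) \<Rightarrow> (real \<Rightarrow> real) \<Rightarrow> (real \<Rightarrow> real) \<Rightarrow> real \<Rightarrow> real" where
  "alpha_Y_tilde aW cW bW bV s = alpha_Y aW cW bW (inv_nn (alpha_Y_upper aW cW bW bV) s)"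

text \<open>Iterates of a map \<open>g\<close> on $[0,\infty)$, replaced by their running maximum when \<open>g\<close> is not
  nondecreasing (the supremum below is a maximum for continuous \<open>g\<close>).\<close>

definition mono_iterate :: "(real \<Rightarrow> real) \<Rightarrow> nat \<Rightarrow> real \<Rightarrow> real" where
  "mono_iterate g k s = (if mono_on {0..} g then (g ^^ k) s else (SUP t\<in>{0..s}. (g ^^ k) t))"

definition beta ::
  "(real \<Rightarrow> real) \<Rightarrow> (real \<Rightarrow> real) \<Rightarrow> (real \<Rightarrow> real) \<Rightarrow> (real \<Rightarrow> real) \<Rightarrow> real \<Rightarrow> nat \<Rightarrow> real" where
  "beta aW cW bW bV s k =
     inv_nn (alpha_Y_lower aW cW bW)
       (mono_iterate (\<lambda>t. t - alpha_Y_tilde aW cW bW bV t) k (alpha_Y_upper aW cW bW bV s))"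

end

(* Along the dynamics Y = rho_V(V_r^i) + rho_W(W) (or V_r^i + W when chi_W is below the identity) is a
   Lyapunov function: alpha_Y_lower(sigma) <= Y <= alpha_Y_upper(sigma), and Y drops by at least
   alpha_Y(sigma) at each step, because V_r^i drops by the stage cost and V_r^i <= V_r^0.

   V_r^(i+1) <= V_r^i needs a policy with values in the argmin H^(i+1), hence lower semicontinuity of
   V_r^i.  This is propagated by value iteration: for an outer semicontinuous S with nonempty values,
   the infimum of J(x,h) over selections h of S is the increasing limit of the value iterates over S,
   whose sublevel sets are closed by level-boundedness of the stage cost.

   beta is of class KL only if alpha_Y <= alpha_Y_upper on all of [0,oo).  Nonnegativity of Y gives this
   on the range of sigma, which contains every s > 0: sigma is unbounded since its sublevel sets
   are compact, and its infimum is 0 since otherwise Y would decrease to -oo. *)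
theory Submission
  imports Defs
begin

section \<open>Comparison functions\<close>

lemma K_inf_nonneg: "class_K_inf a \<Longrightarrow> 0 \<le> s \<Longrightarrow> 0 \<le> a s"
  unfolding class_K_inf_def by auto

lemma K_inf_zero: "class_K_inf a \<Longrightarrow> a 0 = 0"
  unfolding class_K_inf_def by auto

lemma K_inf_less_iff: "class_K_inf a \<Longrightarrow> 0 \<le> s \<Longrightarrow> 0 \<le> t \<Longrightarrow> a s < a t \<longleftrightarrow> s < t"
  unfolding class_K_inf_def using strict_mono_on_less[of "{0..}" a s t] by auto

lemma K_inf_le_iff: "class_K_inf a \<Longrightarrow> 0 \<le> s \<Longrightarrow> 0 \<le> t \<Longrightarrow> a s \<le> a t \<longleftrightarrow> s \<le> t"
  using K_inf_less_iff[of a t s] by (simp add: not_less[symmetric])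

lemma K_inf_pos: "class_K_inf a \<Longrightarrow> 0 < s \<Longrightarrow> 0 < a s"
  using K_inf_less_iff[of a 0 s] K_inf_zero[of a] by simp

lemma K_inf_continuous: "class_K_inf a \<Longrightarrow> continuous_on {0..} a"
  unfolding class_K_inf_def by auto

lemma K_inf_unbounded:
  assumes "class_K_inf a"
  obtains s where "0 \<le> s" "B < a s"
proof -
  have "\<not> bdd_above (a ` {0..})" using assms unfolding class_K_inf_def by auto
  then show thesis using that unfolding bdd_above_def by (force simp: not_le)
qed

lemma K_inf_image:
  assumes a: "class_K_inf a"
  shows "a ` {0..} = {0..}"
proof
  show "a ` {0..} \<subseteq> {0..}" using K_inf_nonneg[OF a] by auto
  show "{0..} \<subseteq> a ` {0..}"
  proof
    fix y :: real assume y: "y \<in> {0..}"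
    obtain s where s: "0 \<le> s" "y < a s" using K_inf_unbounded[OF a] .
    have "\<exists>x\<ge>0. x \<le> s \<and> a x = y"
      using s y K_inf_zero[OF a] continuous_on_subset[OF K_inf_continuous[OF a]]
      by (intro IVT') auto
    then show "y \<in> a ` {0..}" by auto
  qed
qed

text \<open>A strictly increasing surjection of \<open>[0,\<infinity>)\<close> extends by the identity to an
  increasing surjection of the line, which is continuous since its image is open.\<close>
lemma K_infI_image:
  fixes a :: "real \<Rightarrow> real"
  assumes mono: "strict_mono_on {0..} a" and im: "a ` {0..} = {0..}"
  shows "class_K_inf a"
proof -
  obtain s where s: "s \<ge> 0" "a s = 0" using im by (metis atLeast_iff imageE order_refl)
  have nn: "a t \<ge> 0" if "t \<ge> 0" for t using im that by blast
  have a0: "a 0 = 0"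
    using strict_mono_onD[OF mono, of 0 s] s nn[of 0] by (cases "s = 0") auto
  define e where "e t = (if t \<ge> 0 then a t else t)" for t
  have "range e = UNIV"
  proof -
    have "t \<in> range e" for t
    proof (cases "t \<ge> 0")
      case True
      then obtain r where "r \<ge> 0" "a r = t" using im by (metis atLeast_iff imageE)
      then have "e r = t" by (simp add: e_def)
      then show ?thesis by blast
    next
      case False
      then have "e t = t" by (simp add: e_def)
      then show ?thesis by (metis rangeI)
    qed
    then show ?thesis by blast
  qed
  moreover have "e x \<le> e y" if "x \<le> y" for x y
  proof (cases "x = y")
    case False
    then show ?thesis
      using that nn[of y] strict_mono_onD[OF mono, of x y] by (auto simp: e_def)
  qed simp
  ultimately have "continuous_on UNIV e" by (intro continuous_onI_mono) auto
  then have "continuous_on {0..} e" by (rule continuous_on_subset) simp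
  then have "continuous_on {0..} a" by (rule continuous_on_eq) (simp add: e_def)
  moreover have "\<not> bdd_above {0::real..}" 
    unfolding bdd_above_def
  proof
    assume "\<exists>M. \<forall>x\<in>{0::real..}. x \<le> M"
    then obtain M where "\<And>x::real. 0 \<le> x \<Longrightarrow> x \<le> M" by auto
    from this[of "\<bar>M\<bar> + 1"] show False by simp
  qed
  ultimately show ?thesis using mono a0 im unfolding class_K_inf_def by simp
qed

lemma K_inf_strict_mono: "class_K_inf a \<Longrightarrow> strict_mono_on {0..} a"
  unfolding class_K_inf_def by auto

lemma K_inf_inj: "class_K_inf a \<Longrightarrow> inj_on a {0..}"
  using K_inf_strict_mono strict_mono_on_imp_inj_on by blast

lemma inv_nn_left: "class_K_inf a \<Longrightarrow> 0 \<le> s \<Longrightarrow> inv_nn a (a s) = s"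
  unfolding inv_nn_def using inv_into_f_f[OF K_inf_inj] by simp

lemma inv_nn_right: "class_K_inf a \<Longrightarrow> 0 \<le> t \<Longrightarrow> a (inv_nn a t) = t"
  unfolding inv_nn_def by (rule f_inv_into_f) (simp add: K_inf_image)

lemma inv_nn_nonneg: "class_K_inf a \<Longrightarrow> 0 \<le> t \<Longrightarrow> 0 \<le> inv_nn a t"
  unfolding inv_nn_def using inv_into_into[of t a "{0..}"] by (simp add: K_inf_image)

text \<open>Continuity of the inverse comes for free from surjectivity through
  \<open>K_infI_image\<close>.\<close>

lemma K_inf_inv_nn:
  assumes a: "class_K_inf a"
  shows "class_K_inf (inv_nn a)"
proof (rule K_infI_image)
  show "strict_mono_on {0..} (inv_nn a)"
  proof (rule strict_mono_onI)
    fix r s :: real assume "r \<in> {0..}" "s \<in> {0..}" "r < s"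
    then show "inv_nn a r < inv_nn a s"
      using K_inf_less_iff[OF a, of "inv_nn a r" "inv_nn a s"] inv_nn_nonneg[OF a] inv_nn_right[OF a]
      by simp
  qed
  show "inv_nn a ` {0..} = {0..}"
  proof
    show "inv_nn a ` {0..} \<subseteq> {0..}" using inv_nn_nonneg[OF a] by auto
    show "{0..} \<subseteq> inv_nn a ` {0..}"
      using inv_nn_left[OF a] K_inf_nonneg[OF a] by (metis atLeast_iff image_eqI subsetI)
  qed
qed

lemma K_inf_compose:
  assumes a: "class_K_inf a" and b: "class_K_inf b"
  shows "class_K_inf (\<lambda>s. a (b s))"
proof (rule K_infI_image)
  show "strict_mono_on {0..} (\<lambda>s. a (b s))"
    by (rule strict_mono_onI)
      (simp add: K_inf_less_iff[OF a] K_inf_less_iff[OF b] K_inf_nonneg[OF b])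
  show "(\<lambda>s. a (b s)) ` {0..} = {0..}"
    using K_inf_image[OF a] K_inf_image[OF b] by (metis image_image)
qed

lemma K_inf_scale:
  assumes "0 < c"
  shows "class_K_inf (\<lambda>s. c * s)"
proof (rule K_infI_image)
  show "strict_mono_on {0..} (\<lambda>s. c * s)" using assms by (auto intro: strict_mono_onI)
  show "(\<lambda>s. c * s) ` {0..} = {0..}"
  proof
    show "{0..} \<subseteq> (\<lambda>s. c * s) ` {0..}"
    proof
      fix y :: real assume "y \<in> {0..}"
      then show "y \<in> (\<lambda>s. c * s) ` {0..}" using assms by (intro image_eqI[of _ _ "y / c"]) auto
    qed
  qed (use assms in auto)
qed

text \<open>The second summand is only nondecreasing because this is all that is known of
  \<open>bW\<close>.\<close>

lemma K_inf_add:
  assumes a: "class_K_inf a"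
    and b: "continuous_on {0..} b" "mono_on {0..} b" "b 0 = 0"
  shows "class_K_inf (\<lambda>s. a s + b s)"
proof -
  have bm: "b s \<le> b t" if "0 \<le> s" "s \<le> t" for s t using b(2) that by (auto simp: mono_on_def)
  have bn: "0 \<le> b s" if "0 \<le> s" for s using bm[of 0 s] b(3) that by simp
  have "strict_mono_on {0..} (\<lambda>s. a s + b s)"
    by (rule strict_mono_onI, rule add_less_le_mono) (auto simp: K_inf_less_iff[OF a] intro: bm)
  moreover have "\<not> bdd_above ((\<lambda>s. a s + b s) ` {0..})"
  proof
    assume "bdd_above ((\<lambda>s. a s + b s) ` {0..})"
    then obtain M where M: "\<And>s. 0 \<le> s \<Longrightarrow> a s + b s \<le> M" unfolding bdd_above_def by auto
    obtain s where "0 \<le> s" "M < a s" using K_inf_unbounded[OF a] .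
    then show False using M[of s] bn[of s] by simp
  qed
  ultimately show ?thesis
    unfolding class_K_inf_def
    using K_inf_nonneg[OF a] K_inf_zero[OF a] K_inf_continuous[OF a] b bn
    by (auto intro!: continuous_intros add_nonneg_nonneg)
qed

lemma K_inf_mono_on: "class_K_inf a \<Longrightarrow> mono_on {0..} a"
  by (auto simp: mono_on_def K_inf_le_iff)

lemma K_inf_min:
  assumes a: "class_K_inf a" and b: "class_K_inf b"
  shows "class_K_inf (\<lambda>s. min (a s) (b s))"
proof -
  have "strict_mono_on {0..} (\<lambda>s. min (a s) (b s))"
    by (rule strict_mono_onI) (auto simp: min_less_iff_conj min_less_iff_disj K_inf_less_iff[OF a] K_inf_less_iff[OF b])
  moreover have "\<not> bdd_above ((\<lambda>s. min (a s) (b s)) ` {0..})"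
  proof
    assume "bdd_above ((\<lambda>s. min (a s) (b s)) ` {0..})"
    then obtain M where M: "\<And>s. 0 \<le> s \<Longrightarrow> min (a s) (b s) \<le> M" unfolding bdd_above_def by auto
    obtain s where s: "0 \<le> s" "M < a s" using K_inf_unbounded[OF a] .
    obtain t where t: "0 \<le> t" "M < b t" using K_inf_unbounded[OF b] .
    have "M < a (max s t)" "M < b (max s t)"
      using s t K_inf_le_iff[OF a, of s "max s t"] K_inf_le_iff[OF b, of t "max s t"]
      by (auto simp: le_max_iff_disj)
    then show False using M[of "max s t"] s(1) by (simp add: le_max_iff_disj min_le_iff_disj)
  qed
  ultimately show ?thesis
    unfolding class_K_inf_def
    using K_inf_nonneg[OF a] K_inf_nonneg[OF b] K_inf_zero[OF a] K_inf_zero[OF b]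
      K_inf_continuous[OF a] K_inf_continuous[OF b]
    by (auto intro!: continuous_intros)
qed

section \<open>Primitives of class K-infinity functions\<close>

text \<open>On \<open>{s..t}\<close> an increasing integrand lies between its endpoint values. These
  one-cell Riemann bounds also drive the estimates of \<open>rho_V\<close> and \<open>rho_W\<close>
  along the dynamics.\<close>

lemma K_inf_integral_bounds:
  assumes q: "class_K_inf q" and "0 \<le> s" "s \<le> t"
  shows "(t - s) * q s \<le> integral {0..t} q - integral {0..s} q"
    and "integral {0..t} q - integral {0..s} q \<le> (t - s) * q t"
proof -
  have int: "q integrable_on {a..b}" if "0 \<le> a" for a b
    by (rule integrable_continuous_interval)
      (rule continuous_on_subset[OF K_inf_continuous[OF q]], use that in auto)
  have "integral {0..s} q + integral {s..t} q = integral {0..t} q"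
    using assms int by (intro Henstock_Kurzweil_Integration.integral_combine) auto
  moreover have "(t - s) * q s \<le> integral {s..t} q"
    using integral_le[of "\<lambda>_. q s" "{s..t}" q] integrable_const_ivl[of "q s" s t] int[of s t]
      assms K_inf_le_iff[OF q] by simp
  moreover have "integral {s..t} q \<le> (t - s) * q t"
    using integral_le[of q "{s..t}" "\<lambda>_. q t"] integrable_const_ivl[of "q t" s t] int[of s t]
      assms K_inf_le_iff[OF q] by simp
  ultimately show "(t - s) * q s \<le> integral {0..t} q - integral {0..s} q"
    and "integral {0..t} q - integral {0..s} q \<le> (t - s) * q t" by linarith+
qed

lemma K_inf_integral:
  assumes q: "class_K_inf q"
  shows "class_K_inf (\<lambda>s. integral {0..s} q)" (is "class_K_inf ?r")
proof -
  have zero: "?r 0 = 0" by simp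
  have less: "?r s < ?r t" if "0 \<le> s" "s < t" for s t
  proof -
    \<comment> \<open>The lower bound on all of \<open>{s..t}\<close> degenerates at
      \<open>s = 0\<close>, where \<open>q\<close> vanishes; the upper half still contributes a
      positive amount.\<close>
    let ?m = "(s + t) / 2"
    have "0 \<le> (?m - s) * q s" using that K_inf_nonneg[OF q, of s] by simp
    moreover have "0 < (t - ?m) * q ?m" using that K_inf_pos[OF q, of ?m] by simp
    ultimately show ?thesis
      using K_inf_integral_bounds(1)[OF q, of s ?m] K_inf_integral_bounds(1)[OF q, of ?m t] that
      by simp
  qed
  have "\<not> bdd_above (?r ` {0..})"
  proof
    assume "bdd_above (?r ` {0..})"
    then obtain M where M: "\<And>s. 0 \<le> s \<Longrightarrow> ?r s \<le> M" unfolding bdd_above_def by auto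
    have q1: "0 < q 1" using K_inf_pos[OF q] by simp
    \<comment> \<open>Beyond 1 the primitive grows at rate at least \<open>q 1\<close>, so at this
      point it exceeds \<open>\<bar>M\<bar>\<close>.\<close>
    let ?t = "1 + (\<bar>M\<bar> + 1) / q 1"
    have t: "1 \<le> ?t" using q1 by simp
    have "\<bar>M\<bar> + 1 = (?t - 1) * q 1" using q1 by simp
    also have "\<dots> \<le> ?r ?t - ?r 1" using K_inf_integral_bounds(1)[OF q _ t] by simp
    also have "\<dots> \<le> ?r ?t" using less[of 0 1] zero by simp
    also have "\<dots> \<le> M" using M t by simp
    finally show False by simp
  qed
  moreover have "continuous_on {0..} ?r"
    unfolding continuous_on_eq_continuous_within
  proof
    fix x :: real assume x: "x \<in> {0..}"
    \<comment> \<open>Continuity of the primitive is available on compact intervals; ending at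
      \<open>x + 1\<close> leaves room to the right of \<open>x\<close>, so the filter at
      \<open>x\<close> is that of the half-line.\<close>
    have "continuous_on {0..x + 1} ?r"
      by (rule indefinite_integral_continuous_1, rule integrable_continuous_interval,
          rule continuous_on_subset[OF K_inf_continuous[OF q]]) auto
    then have "continuous (at x within {0..x + 1}) ?r"
      using x by (simp add: continuous_on_eq_continuous_within)
    moreover have "at x within {0..x + 1} = at x within {0..}"
      by (rule at_within_nhd[of x "{x - 1<..<x + 1}"]) (use x in auto)
    ultimately show "continuous (at x within {0..}) ?r" by simp
  qed
  moreover have "?r ` {0..} \<subseteq> {0..}" using less[of 0] zero by (auto simp: le_less)
  moreover have "strict_mono_on {0..} ?r" by (rule strict_mono_onI) (use less in auto)
  ultimately show ?thesis unfolding class_K_inf_def using zero by simp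
qed

section \<open>Iterates of a map strictly below the identity, not assumed monotone\<close>

locale damped_map =
  fixes g :: "real \<Rightarrow> real"
  assumes cont: "continuous_on {0..} g"
    and nonneg: "\<And>t. 0 \<le> t \<Longrightarrow> 0 \<le> g t"
    and less: "\<And>t. 0 < t \<Longrightarrow> g t < t"
begin

text \<open>The strict inequality is assumed only for positive arguments; continuity carries it, in
  weak form, to 0.\<close>

lemma zero: "g 0 = 0"
proof (rule antisym)
  have "(g \<longlongrightarrow> g 0) (at 0 within {0..})" using cont by (auto simp: continuous_on)
  then have "(g \<longlongrightarrow> g 0) (at_right 0)"
    by (rule tendsto_within_subset) auto
  moreover have "((\<lambda>t. t) \<longlongrightarrow> (0::real)) (at_right 0)" by (rule tendsto_ident_at)
  moreover have "eventually (\<lambda>t. g t \<le> t) (at_right 0)"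
    using less by (auto simp: eventually_at_filter less_imp_le)
  ultimately show "g 0 \<le> 0" by (intro tendsto_le[of "at_right 0"]) auto
qed (use nonneg in auto)

lemma le: "0 \<le> t \<Longrightarrow> g t \<le> t"
  using less zero by (cases "t = 0") (auto simp: less_imp_le)

lemma iterate_nonneg: "0 \<le> t \<Longrightarrow> 0 \<le> (g ^^ k) t"
  by (induction k) (auto intro: nonneg)

lemma iterate_zero: "(g ^^ k) 0 = 0"
  by (induction k) (auto simp: zero)

lemma continuous_iterate: "continuous_on {0..} (g ^^ k)"
proof (induction k)
  case (Suc k)
  have "continuous_on {0..} (g \<circ> (g ^^ k))"
    using Suc iterate_nonneg by (intro continuous_on_compose continuous_on_subset[OF cont]) auto
  then show ?case by simp
qed (simp add: continuous_on_id)

text \<open>This image treats the two cases of \<^const>\<open>mono_iterate\<close> alike from here on.\<close>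
lemma image_iterate:
  assumes s: "0 \<le> s"
  shows "(g ^^ k) ` {0..s} = {0..mono_iterate g k s}"
proof -
  have c: "continuous_on {0..s} (g ^^ k)" using continuous_iterate by (rule continuous_on_subset) auto
  have "connected ((g ^^ k) ` {0..s})" using c by (intro connected_continuous_image) auto
  moreover have "compact ((g ^^ k) ` {0..s})" using c by (intro compact_continuous_image) auto
  ultimately obtain a b where ab: "(g ^^ k) ` {0..s} = {a..b}"
    using connected_compact_interval_1 by blast
  have "(g ^^ k) 0 \<in> (g ^^ k) ` {0..s}" using s by (intro imageI) simp
  then have "0 \<in> {a..b}" unfolding ab iterate_zero .
  moreover have "{a..b} \<subseteq> {0..}" unfolding ab[symmetric] using iterate_nonneg by auto
  ultimately have a: "a = 0" "0 \<le> b" by auto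
  have "mono_iterate g k s = b"
  proof (cases "mono_on {0..} g")
    case True
    have m: "(g ^^ k) t \<le> (g ^^ k) s" if "0 \<le> t" "t \<le> s" for t
      by (induction k) (use True that iterate_nonneg s in \<open>auto simp: mono_on_def\<close>)
    have "b \<in> (g ^^ k) ` {0..s}" unfolding ab using a by simp
    then have "b \<le> (g ^^ k) s" using m by auto
    moreover have "(g ^^ k) s \<in> {a..b}" unfolding ab[symmetric] using s by auto
    ultimately show ?thesis using True by (simp add: mono_iterate_def)
  next
    case False
    then show ?thesis using ab a by (simp add: mono_iterate_def)
  qed
  then show ?thesis using ab a by simp
qed

lemma mono_iterate_nonneg: "0 \<le> s \<Longrightarrow> 0 \<le> mono_iterate g k s"
  using image_iterate[of s k] by (metis atLeastAtMost_iff atLeastatMost_empty_iff empty_iff imageI order.refl)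

text \<open>This is the recursion for running maxima: since the image of \<open>{0..s}\<close> under
  each iterate is an interval starting at 0, one more application of \<open>g\<close> acts on that
  interval.\<close>

lemma image_mono_iterate:
  assumes "0 \<le> s"
  shows "g ` {0..mono_iterate g k s} = {0..mono_iterate g (Suc k) s}"
  using image_iterate[OF assms, of k] image_iterate[OF assms, of "Suc k"]
  by (metis funpow.simps(2) image_comp)

lemma mono_iterate_0: "0 \<le> s \<Longrightarrow> mono_iterate g 0 s = s"
  using image_iterate[of s 0] mono_iterate_nonneg[of s 0] by (simp add: Icc_eq_Icc)

text \<open>Without monotonicity of \<open>g\<close>, the next maximum need not be \<open>g\<close>
  of the current one; it is \<open>g\<close> of some point below it.\<close>

lemma mono_iterate_attained:
  assumes "0 \<le> s"
  obtains t where "0 \<le> t" "t \<le> mono_iterate g k s" "mono_iterate g (Suc k) s = g t"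
proof -
  have "mono_iterate g (Suc k) s \<in> g ` {0..mono_iterate g k s}"
    unfolding image_mono_iterate[OF assms] using mono_iterate_nonneg[OF assms] by simp
  then show thesis using that by auto
qed

lemma mono_iterate_Suc_le: "0 \<le> s \<Longrightarrow> mono_iterate g (Suc k) s \<le> mono_iterate g k s"
  by (metis le mono_iterate_attained order.trans)

lemma mono_iterate_antimono: "0 \<le> s \<Longrightarrow> antimono (\<lambda>k. mono_iterate g k s)"
  using mono_iterate_Suc_le by (simp add: antimono_iff_le_Suc)

lemma mono_iterate_mono:
  assumes "0 \<le> s" "s \<le> t"
  shows "mono_iterate g k s \<le> mono_iterate g k t"
proof -
  have "{0..mono_iterate g k s} \<subseteq> {0..mono_iterate g k t}"
    using image_iterate[of s k] image_iterate[of t k] assms by (metis atLeastatMost_subset_iff image_mono order.refl order.trans)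
  then show ?thesis using mono_iterate_nonneg[of s k] assms by auto
qed

text \<open>Each value is \<open>g\<close> of a point squeezed between it and its predecessor, so the limit
  is a fixed point of \<open>g\<close>.\<close>
lemma mono_iterate_tendsto_0:
  assumes s: "0 \<le> s"
  shows "(\<lambda>k. mono_iterate g k s) \<longlonglongrightarrow> 0"
proof -
  let ?m = "\<lambda>k. mono_iterate g k s"
  obtain L where L: "?m \<longlonglongrightarrow> L" "\<And>k. L \<le> ?m k"
    using decseq_convergent[OF mono_iterate_antimono[OF s], of 0] mono_iterate_nonneg[OF s] by blast
  have L0: "0 \<le> L" using L(1) mono_iterate_nonneg[OF s] by (intro LIMSEQ_le_const) auto
  have "\<forall>k. \<exists>t. 0 \<le> t \<and> t \<le> ?m k \<and> ?m (Suc k) = g t"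
    by (meson mono_iterate_attained[OF s])
  then obtain t where t: "\<And>k. 0 \<le> t k" "\<And>k. t k \<le> ?m k" "\<And>k. ?m (Suc k) = g (t k)" by metis
  have "?m (Suc k) \<le> t k" for k using t(1,3) le by simp
  then have "t \<longlonglongrightarrow> L"
    using t(2) L(1) LIMSEQ_Suc[OF L(1)] by (intro tendsto_sandwich[of "\<lambda>k. ?m (Suc k)" t _ ?m]) auto
  then have "(\<lambda>k. g (t k)) \<longlonglongrightarrow> g L"
    using t(1) L0 by (intro continuous_on_tendsto_compose[OF cont]) auto
  then have "g L = L" using LIMSEQ_Suc[OF L(1)] t(3) LIMSEQ_unique by simp
  then have "L = 0" using less[of L] L0 by (cases "L = 0") auto
  then show ?thesis using L(1) by simp
qed

text \<open>A comparison principle that survives a non-monotone \<open>g\<close>: the induction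
  keeps \<open>y k\<close> in the interval from 0 to the running maximum, and \<open>g\<close> maps
  this interval onto the next one.\<close>

lemma mono_iterate_bound:
  assumes "\<And>k. 0 \<le> y k" "\<And>k. y (Suc k) \<le> g (y k)" "y 0 \<le> s"
  shows "y k \<le> mono_iterate g k s"
proof (induction k)
  case 0
  have "0 \<le> s" using assms(1)[of 0] assms(3) by simp
  then show ?case using assms(3) by (simp add: mono_iterate_0)
next
  case (Suc k)
  have "0 \<le> s" using assms(1)[of 0] assms(3) by simp
  moreover have "g (y k) \<in> g ` {0..mono_iterate g k s}" using Suc assms(1) by auto
  ultimately have "g (y k) \<le> mono_iterate g (Suc k) s" by (simp only: image_mono_iterate) simp
  then show ?case using assms(2)[of k] by simp
qed

end

section \<open>From a Lyapunov decrease to a class KL bound\<close>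

text \<open>The upper bound on \<open>y\<close> turns the decrease by \<open>aY (s k)\<close> into
  \<open>y (Suc k) \<le> g (y k)\<close> with \<open>g\<close> the identity minus \<open>aY\<close>
  composed with the inverse of \<open>aU\<close>. The inequality \<open>aY \<le> aU\<close> is
  exactly what keeps \<open>g\<close> nonnegative, so that the results on damped maps apply.\<close>

lemma lyapunov_class_KL:
  assumes aL: "class_K_inf aL" and aU: "class_K_inf aU"
    and aY: "continuous_on {0..} aY" "mono_on {0..} aY" "aY 0 = 0" "\<And>s. 0 < s \<Longrightarrow> 0 < aY s"
    and aY_le: "\<And>s. 0 \<le> s \<Longrightarrow> aY s \<le> aU s"
  defines "b \<equiv> \<lambda>s. \<lambda>k. inv_nn aL (mono_iterate (\<lambda>t. t - aY (inv_nn aU t)) k (aU s))"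
  shows "class_KL b"
    and "\<And>s y k. (\<And>k. 0 \<le> s k) \<Longrightarrow> (\<And>k. aL (s k) \<le> y k) \<Longrightarrow> (\<And>k. y k \<le> aU (s k))
      \<Longrightarrow> (\<And>k. y (Suc k) \<le> y k - aY (s k)) \<Longrightarrow> s k \<le> b (s 0) k"
proof -
  let ?g = "\<lambda>t. t - aY (inv_nn aU t)"
  let ?m = "mono_iterate ?g"
  interpret damped_map ?g
  proof
    have "continuous_on {0..} (aY \<circ> inv_nn aU)"
      using K_inf_continuous[OF K_inf_inv_nn[OF aU]] inv_nn_nonneg[OF aU]
      by (intro continuous_on_compose continuous_on_subset[OF aY(1)]) auto
    then show "continuous_on {0..} ?g" by (intro continuous_intros) (simp add: o_def)
    show "0 \<le> t - aY (inv_nn aU t)" if "0 \<le> t" for t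
      using aY_le[OF inv_nn_nonneg[OF aU that]] inv_nn_right[OF aU that] by simp
    show "t - aY (inv_nn aU t) < t" if "0 < t" for t
      using aY(4)[OF K_inf_pos[OF K_inf_inv_nn[OF aU] that]] by simp
  qed
  have iL: "class_K_inf (inv_nn aL)" by (rule K_inf_inv_nn[OF aL])
  have m0: "0 \<le> ?m k (aU s)" if "0 \<le> s" for s k
    using mono_iterate_nonneg K_inf_nonneg[OF aU that] .
  have b0: "0 \<le> b s k" if "0 \<le> s" for s k
    unfolding b_def using K_inf_nonneg[OF iL m0[OF that]] .
  have anti: "antimono (b s)" if "0 \<le> s" for s
    using antimonoD[OF mono_iterate_antimono[OF K_inf_nonneg[OF aU that]]] m0[OF that]
    by (intro antimonoI) (simp add: b_def K_inf_le_iff[OF iL])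
  have lim: "b s \<longlonglongrightarrow> 0" if "0 \<le> s" for s
  proof -
    have "(\<lambda>k. inv_nn aL (?m k (aU s))) \<longlonglongrightarrow> inv_nn aL 0"
      using mono_iterate_tendsto_0[OF K_inf_nonneg[OF aU that]] m0[OF that]
      by (intro continuous_on_tendsto_compose[OF K_inf_continuous[OF iL]]) auto
    then show ?thesis by (simp add: b_def K_inf_zero[OF iL])
  qed
  have mono: "mono_on {0..} (\<lambda>s. b s k)" for k
    by (rule mono_onI) (simp add: b_def K_inf_le_iff[OF iL] m0 mono_iterate_mono K_inf_nonneg[OF aU] K_inf_le_iff[OF aU])
  \<comment> \<open>The bound for \<open>k = 0\<close> dominates all later ones and is itself of
    class K-infinity in \<open>s\<close>.\<close>
  have right: "((\<lambda>s. b s k) \<longlongrightarrow> 0) (at_right 0)" for k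
  proof (rule tendsto_sandwich[of "\<lambda>_. 0" "\<lambda>s. b s k" _ "\<lambda>s. inv_nn aL (aU s)"])
    show "eventually (\<lambda>s. 0 \<le> b s k) (at_right 0)"
      using b0 by (auto simp: eventually_at_filter)
    have "b s k \<le> inv_nn aL (aU s)" if "0 \<le> s" for s
      using antimonoD[OF anti[OF that], of 0 k] mono_iterate_0[OF K_inf_nonneg[OF aU that]]
      by (simp add: b_def)
    then show "eventually (\<lambda>s. b s k \<le> inv_nn aL (aU s)) (at_right 0)"
      by (auto simp: eventually_at_filter)
    have c: "class_K_inf (\<lambda>s. inv_nn aL (aU s))" by (rule K_inf_compose[OF iL aU])
    have "((\<lambda>s. inv_nn aL (aU s)) \<longlongrightarrow> inv_nn aL (aU 0)) (at 0 within {0..})"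
      using K_inf_continuous[OF c] by (auto simp: continuous_on)
    then have "((\<lambda>s. inv_nn aL (aU s)) \<longlongrightarrow> inv_nn aL (aU 0)) (at_right 0)"
      by (rule tendsto_within_subset) auto
    then show "((\<lambda>s. inv_nn aL (aU s)) \<longlongrightarrow> 0) (at_right 0)" by (simp add: K_inf_zero[OF c])
  qed simp
  show "class_KL b" unfolding class_KL_def using b0 anti lim mono right by blast
  fix s y :: "nat \<Rightarrow> real" and k
  assume s: "\<And>k. 0 \<le> s k" and low: "\<And>k. aL (s k) \<le> y k" and up: "\<And>k. y k \<le> aU (s k)"
    and dec: "\<And>k. y (Suc k) \<le> y k - aY (s k)"
  have y0: "0 \<le> y k" for k using low[of k] K_inf_nonneg[OF aL s[of k]] by simp
  have "y (Suc k) \<le> ?g (y k)" for k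
  proof -
    have "inv_nn aU (y k) \<le> inv_nn aU (aU (s k))"
      using up y0 K_inf_nonneg[OF aU s] by (simp add: K_inf_le_iff[OF K_inf_inv_nn[OF aU]])
    then have "aY (inv_nn aU (y k)) \<le> aY (s k)"
      using aY(2) s inv_nn_nonneg[OF aU y0] by (simp add: inv_nn_left[OF aU] mono_on_def)
    then show ?thesis using dec[of k] by simp
  qed
  then have "y k \<le> ?m k (aU (s 0))" by (rule mono_iterate_bound[OF y0 _ up])
  then have "aL (s k) \<le> ?m k (aU (s 0))" using low[of k] by simp
  then have "inv_nn aL (aL (s k)) \<le> inv_nn aL (?m k (aU (s 0)))"
    using K_inf_nonneg[OF aL s] m0[OF s] by (simp add: K_inf_le_iff[OF iL])
  then show "s k \<le> b (s 0) k" using s by (simp add: b_def inv_nn_left[OF aL])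
qed

section \<open>The functions of the bound and the Lyapunov estimates for numbers\<close>

locale detectability_functions =
  fixes aW cW bW bV :: "real \<Rightarrow> real"
  assumes aW: "class_K_inf aW" and cW: "class_K_inf cW" and bV: "class_K_inf bV"
    and bW: "bW ` {0..} \<subseteq> {0..}" "continuous_on {0..} bW" "mono_on {0..} bW" "bW 0 = 0"
begin

text \<open>The function inverted in \<open>q_W\<close>. If \<open>cW c\<close> exceeds half of
  \<open>aW s\<close>, then \<open>s\<close> is at most the inverse of \<open>aW\<close> at
  \<open>2 * cW c\<close>, so \<open>theta c\<close> dominates \<open>cW c + bW s\<close>, which
  bounds the next value of W.\<close>

definition theta :: "real \<Rightarrow> real" where
  "theta t = cW t + (bW (inv_nn aW (2 * cW t)) + inv_nn aW (2 * cW t))"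

lemma bW_nonneg: "0 \<le> s \<Longrightarrow> 0 \<le> bW s"
  using bW(1) by auto

lemma bW_mono: "0 \<le> s \<Longrightarrow> s \<le> t \<Longrightarrow> bW s \<le> bW t"
  using bW(3) by (auto simp: mono_on_def)

lemma K_inf_theta: "class_K_inf theta"
proof -
  have 1: "class_K_inf (\<lambda>t. inv_nn aW (2 * cW t))"
    by (rule K_inf_compose[OF K_inf_inv_nn[OF aW] K_inf_compose[OF K_inf_scale cW]]) simp
  have "class_K_inf (\<lambda>t. inv_nn aW (2 * cW t) + bW (inv_nn aW (2 * cW t)))"
  proof (rule K_inf_add[OF 1])
    have "continuous_on {0..} (bW \<circ> (\<lambda>t. inv_nn aW (2 * cW t)))"
      using K_inf_continuous[OF 1] K_inf_nonneg[OF 1]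
      by (intro continuous_on_compose continuous_on_subset[OF bW(2)]) auto
    then show "continuous_on {0..} (\<lambda>t. bW (inv_nn aW (2 * cW t)))" by (simp add: o_def)
    show "mono_on {0..} (\<lambda>t. bW (inv_nn aW (2 * cW t)))"
      by (rule mono_onI) (use K_inf_nonneg[OF 1] K_inf_le_iff[OF 1] bW_mono in auto)
    show "bW (inv_nn aW (2 * cW 0)) = 0" using K_inf_zero[OF 1] bW(4) by simp
  qed
  then have 2: "class_K_inf (\<lambda>t. bW (inv_nn aW (2 * cW t)) + inv_nn aW (2 * cW t))"
    by (simp add: add.commute)
  show ?thesis
    using K_inf_add[OF cW K_inf_continuous[OF 2] K_inf_mono_on[OF 2] K_inf_zero[OF 2]]
    unfolding theta_def by simp
qed

lemma q_W_eq: "q_W aW cW bW = (\<lambda>s. 1/2 * inv_nn theta s)"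
  unfolding q_W_def theta_def by simp

lemma K_inf_q_W: "class_K_inf (q_W aW cW bW)"
  unfolding q_W_eq by (rule K_inf_compose[OF K_inf_scale K_inf_inv_nn[OF K_inf_theta]]) simp

lemma q_W_theta: "0 \<le> t \<Longrightarrow> q_W aW cW bW (theta t) = t / 2"
  by (simp add: q_W_eq inv_nn_left[OF K_inf_theta])

lemma K_inf_q_V: "class_K_inf (q_V cW)"
  unfolding q_V_def[abs_def]
  by (rule K_inf_compose[OF K_inf_scale K_inf_compose[OF cW K_inf_scale]]) auto

lemma K_inf_rho_V: "class_K_inf (rho_V cW)"
  unfolding rho_V_def[abs_def] by (rule K_inf_integral[OF K_inf_q_V])

lemma K_inf_rho_W: "class_K_inf (rho_W aW cW bW)"
  unfolding rho_W_def[abs_def] by (rule K_inf_integral[OF K_inf_q_W])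

lemma K_inf_alpha_Y_lower: "class_K_inf (alpha_Y_lower aW cW bW)"
proof (cases "small_gain cW")
  case True
  then show ?thesis using aW by (simp add: alpha_Y_lower_def[abs_def])
next
  case False
  have h: "class_K_inf (\<lambda>s. 1/2 * aW s)" by (rule K_inf_compose[OF K_inf_scale aW]) simp
  show ?thesis
    using False K_inf_min[OF K_inf_compose[OF K_inf_rho_V K_inf_compose[OF K_inf_inv_nn[OF cW] h]]
        K_inf_compose[OF K_inf_rho_W h]]
    by (simp add: alpha_Y_lower_def[abs_def])
qed

lemma K_inf_alpha_Y_upper: "class_K_inf (alpha_Y_upper aW cW bW bV)"
proof (cases "small_gain cW")
  case True
  then show ?thesis using K_inf_add[OF bV bW(2-4)] by (simp add: alpha_Y_upper_def[abs_def])
next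
  case False
  have "continuous_on {0..} (rho_W aW cW bW \<circ> bW)"
    using bW(2) bW_nonneg
    by (intro continuous_on_compose continuous_on_subset[OF K_inf_continuous[OF K_inf_rho_W]]) auto
  then have "class_K_inf (\<lambda>s. rho_V cW (bV s) + rho_W aW cW bW (bW s))"
    by (intro K_inf_add K_inf_compose[OF K_inf_rho_V bV] mono_onI)
      (auto simp: o_def K_inf_le_iff[OF K_inf_rho_W] bW_nonneg bW_mono bW(4) K_inf_zero[OF K_inf_rho_W])
  then show ?thesis using False by (simp add: alpha_Y_upper_def[abs_def])
qed

lemma
  shows continuous_alpha_Y: "continuous_on {0..} (alpha_Y aW cW bW)"
    and mono_alpha_Y: "mono_on {0..} (alpha_Y aW cW bW)"
    and alpha_Y_zero: "alpha_Y aW cW bW 0 = 0"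
    and alpha_Y_pos: "\<And>s. 0 < s \<Longrightarrow> 0 < alpha_Y aW cW bW s"
proof -
  have h: "class_K_inf (\<lambda>s. 1/4 * aW s)" by (rule K_inf_compose[OF K_inf_scale aW]) simp
  have k: "class_K_inf (\<lambda>s. q_W aW cW bW (1/4 * aW s))" by (rule K_inf_compose[OF K_inf_q_W h])
  show "continuous_on {0..} (alpha_Y aW cW bW)"
    using K_inf_continuous[OF aW] continuous_on_mult[OF K_inf_continuous[OF k] K_inf_continuous[OF h]]
    by (cases "small_gain cW") (simp_all add: alpha_Y_def[abs_def])
  show "mono_on {0..} (alpha_Y aW cW bW)"
  proof (rule mono_onI)
    fix r s :: real assume rs: "r \<in> {0..}" "s \<in> {0..}" "r \<le> s"
    have "q_W aW cW bW (1/4 * aW r) * (1/4 * aW r) \<le> q_W aW cW bW (1/4 * aW s) * (1/4 * aW s)"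
      using rs K_inf_le_iff[OF k, of r s] K_inf_le_iff[OF h, of r s]
        K_inf_nonneg[OF k, of s] K_inf_nonneg[OF h, of r]
      by (intro mult_mono) auto
    then show "alpha_Y aW cW bW r \<le> alpha_Y aW cW bW s"
      using rs K_inf_le_iff[OF aW] by (simp add: alpha_Y_def)
  qed
  show "alpha_Y aW cW bW 0 = 0" by (simp add: alpha_Y_def K_inf_zero[OF aW])
  show "0 < alpha_Y aW cW bW s" if "0 < s" for s
    using K_inf_pos[OF aW that] K_inf_pos[OF k that] by (simp add: alpha_Y_def)
qed

text \<open>The arguments are numbers, standing for the values of V_r^i and W at a state; the
  estimates below thus involve no dynamics.\<close>

definition lyapunov :: "real \<Rightarrow> real \<Rightarrow> real" where
  "lyapunov v w = (if small_gain cW then v + w else rho_V cW v + rho_W aW cW bW w)"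

lemma lyapunov_upper:
  assumes "0 \<le> s" "0 \<le> v" "0 \<le> w" "v \<le> bV s" "w \<le> bW s"
  shows "lyapunov v w \<le> alpha_Y_upper aW cW bW bV s"
  using assms K_inf_le_iff[OF K_inf_rho_V, of v "bV s"] K_inf_le_iff[OF K_inf_rho_W, of w "bW s"]
    K_inf_nonneg[OF bV, of s] bW_nonneg[of s]
  by (auto simp: lyapunov_def alpha_Y_upper_def intro: add_mono)

lemma lyapunov_nonneg: "0 \<le> v \<Longrightarrow> 0 \<le> w \<Longrightarrow> 0 \<le> lyapunov v w"
  by (simp add: lyapunov_def K_inf_nonneg[OF K_inf_rho_V] K_inf_nonneg[OF K_inf_rho_W])

text \<open>Since \<open>w'\<close> is nonnegative, \<open>aW s \<le> w + cW c\<close>, so one of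
  the two terms is at least half of \<open>aW s\<close>; this is why the lower bound is a minimum.
  In the small-gain case \<open>cW c \<le> c \<le> v\<close> gives the claim directly.\<close>

lemma lyapunov_lower:
  assumes s: "0 \<le> s" and c: "0 \<le> c" "c \<le> v" and w: "0 \<le> w" "0 \<le> w'" "w' - w \<le> - aW s + cW c"
  shows "alpha_Y_lower aW cW bW s \<le> lyapunov v w"
proof (cases "small_gain cW")
  case True
  then have "cW c \<le> c" using c by (simp add: small_gain_def)
  then show ?thesis using True c w by (simp add: alpha_Y_lower_def lyapunov_def)
next
  case False
  have "cW c \<le> cW v" using c K_inf_le_iff[OF cW] by simp
  then have *: "1/2 * aW s \<le> cW v \<or> 1/2 * aW s \<le> w" using w by linarith
  have a: "0 \<le> 1/2 * aW s" using K_inf_nonneg[OF aW s] by simp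
  have v: "0 \<le> v" using c by simp
  have rho: "0 \<le> rho_V cW v" "0 \<le> rho_W aW cW bW w"
    using K_inf_nonneg[OF K_inf_rho_V v] K_inf_nonneg[OF K_inf_rho_W w(1)] by auto
  have "rho_V cW (inv_nn cW (1/2 * aW s)) \<le> rho_V cW v" if "1/2 * aW s \<le> cW v"
  proof -
    have "inv_nn cW (1/2 * aW s) \<le> inv_nn cW (cW v)"
      using that a K_inf_nonneg[OF cW v] by (simp add: K_inf_le_iff[OF K_inf_inv_nn[OF cW]])
    then show ?thesis
      using inv_nn_nonneg[OF cW a] v inv_nn_left[OF cW v] by (simp add: K_inf_le_iff[OF K_inf_rho_V])
  qed
  moreover have "rho_W aW cW bW (1/2 * aW s) \<le> rho_W aW cW bW w" if "1/2 * aW s \<le> w"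
    using that a w by (simp add: K_inf_le_iff[OF K_inf_rho_W])
  ultimately show ?thesis using * rho False
    by (auto simp: alpha_Y_lower_def lyapunov_def min_le_iff_disj)
qed

text \<open>If \<open>cW c\<close> is at most half of \<open>aW s\<close>, then W itself falls
  enough. Otherwise the stage cost is large compared with sigma, and the drop of the
  \<open>rho_V\<close> term pays for both the growth of the \<open>rho_W\<close> term and
  \<open>alpha_Y\<close>.\<close>

lemma lyapunov_decrease:
  assumes s: "0 \<le> s" and c: "0 \<le> c" and v: "0 \<le> v'" "v' + c \<le> v"
    and w: "0 \<le> w" "0 \<le> w'" "w \<le> bW s" "w' - w \<le> - aW s + cW c"
  shows "lyapunov v' w' \<le> lyapunov v w - alpha_Y aW cW bW s"
proof (cases "small_gain cW")
  case True
  then have "cW c \<le> c" using c by (simp add: small_gain_def)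
  then show ?thesis using True v w by (simp add: alpha_Y_def lyapunov_def)
next
  case False
  let ?q = "q_W aW cW bW" and ?r = "rho_W aW cW bW" and ?a = "aW s" and ?k = "cW c"
  have a: "0 \<le> ?a" and k: "0 \<le> ?k" using K_inf_nonneg[OF aW s] K_inf_nonneg[OF cW c] by auto
  have qm: "?q x \<le> ?q y" if "0 \<le> x" "x \<le> y" for x y
    using that K_inf_le_iff[OF K_inf_q_W] by simp
  have rm: "?r x \<le> ?r y" if "0 \<le> x" "x \<le> y" for x y
    using that K_inf_le_iff[OF K_inf_rho_W] by simp
  have r_low: "(y - x) * ?q x \<le> ?r y - ?r x" and r_up: "?r y - ?r x \<le> (y - x) * ?q y"
    if "0 \<le> x" "x \<le> y" for x y
    using K_inf_integral_bounds[OF K_inf_q_W that] by (auto simp: rho_W_def)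
  \<comment> \<open>Only the interval from \<open>v - c / 2\<close> to \<open>v\<close> is counted.
    As \<open>v \<ge> c\<close>, the integrand there is at least \<open>q_V cW (c / 2)\<close>, that
    is \<open>2 * cW c\<close>; both factors 2 in \<open>q_V\<close> serve this.\<close>
  have V: "rho_V cW v' \<le> rho_V cW v - c * ?k"
  proof -
    have "rho_V cW v' \<le> rho_V cW (v - c / 2)"
      using v c by (simp add: K_inf_le_iff[OF K_inf_rho_V])
    moreover have "c / 2 * q_V cW (v - c / 2) \<le> rho_V cW v - rho_V cW (v - c / 2)"
      using K_inf_integral_bounds(1)[OF K_inf_q_V, of "v - c / 2" v] v c by (simp add: rho_V_def)
    moreover have "q_V cW (c / 2) \<le> q_V cW (v - c / 2)"
      using v c by (simp add: K_inf_le_iff[OF K_inf_q_V])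
    then have "c / 2 * q_V cW (c / 2) \<le> c / 2 * q_V cW (v - c / 2)"
      using c by (intro mult_left_mono) auto
    ultimately show ?thesis by (simp add: q_V_def)
  qed
  have "?r w' + ?q (1/4 * ?a) * (1/4 * ?a) \<le> ?r w + c * ?k"
  proof (cases "?k \<le> ?a / 2")
    case True
    \<comment> \<open>Half of the drop of W is counted: between \<open>w - 1/4 * ?a\<close> and
      \<open>w\<close> the integrand is at least \<open>?q (1/4 * ?a)\<close>, because
      \<open>w\<close> is at least \<open>?a / 2\<close>. Hence the quarters in
      \<open>alpha_Y\<close>.\<close>
    then have w_a: "w' \<le> w - ?a / 2" using w by linarith
    then have "?r w' \<le> ?r (w - 1/4 * ?a)" using w a by (intro rm) auto
    moreover have "1/4 * ?a * ?q (w - 1/4 * ?a) \<le> ?r w - ?r (w - 1/4 * ?a)"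
      using r_low[of "w - 1/4 * ?a" w] w w_a a by simp
    moreover have "?q (1/4 * ?a) \<le> ?q (w - 1/4 * ?a)" using w w_a a by (intro qm) auto
    then have "?q (1/4 * ?a) * (1/4 * ?a) \<le> 1/4 * ?a * ?q (w - 1/4 * ?a)"
      using a by (simp add: mult.commute mult_left_mono)
    moreover have "0 \<le> c * ?k" using c k by simp
    ultimately show ?thesis by linarith
  next
    case False
    have "inv_nn aW ?a \<le> inv_nn aW (2 * ?k)"
      using False a k by (simp add: K_inf_le_iff[OF K_inf_inv_nn[OF aW]])
    then have s_le: "s \<le> inv_nn aW (2 * ?k)" using inv_nn_left[OF aW s] by simp
    then have th: "?k + bW s \<le> theta c" using bW_mono[OF s s_le] s by (simp add: theta_def)
    \<comment> \<open>Both \<open>w'\<close> and \<open>1/4 * ?a\<close> lie in this range. Thanks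
      to the factor one half in \<open>q_W\<close>, each of the two terms to be paid is at most
      \<open>c / 2 * ?k\<close>, and together they use up the gain \<open>c * ?k\<close> from
      \<open>V\<close>.\<close>
    have q1: "?q x \<le> c / 2" if "0 \<le> x" "x \<le> ?k + bW s" for x
      using qm[of x "theta c"] th that q_W_theta[OF c] by simp
    have "?r w' - ?r w \<le> ?k * (c / 2)"
    proof (cases "w' \<le> w")
      case True
      then have "?r w' \<le> ?r w" using w by (intro rm) auto
      moreover have "0 \<le> ?k * (c / 2)" using c k by simp
      ultimately show ?thesis by linarith
    next
      case False
      then have "?r w' - ?r w \<le> (w' - w) * ?q w'" using w by (intro r_up) auto
      also have "\<dots> \<le> ?k * (c / 2)"
        using w a False k K_inf_nonneg[OF K_inf_q_W, of w'] by (intro mult_mono q1) auto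
      finally show ?thesis .
    qed
    moreover have "?q (1/4 * ?a) * (1/4 * ?a) \<le> c / 2 * ?k"
      using False a c k bW_nonneg[OF s] by (intro mult_mono q1) auto
    ultimately show ?thesis by (simp add: field_simps)
  qed
  then show ?thesis using V False by (simp add: alpha_Y_def lyapunov_def)
qed

end

section \<open>Policy iteration\<close>

lemma cost_unroll: "cost f l x h = ennreal (l x (h x)) + cost f l (f x (h x)) h"
proof -
  define a where "a k = ennreal (l (closed_loop f k x h) (h (closed_loop f k x h)))" for k
  have "closed_loop f (Suc k) x h = closed_loop f k (f x (h x)) h" for k
    unfolding closed_loop_def by (simp only: funpow_Suc_right o_apply)
  then have "(\<lambda>k. a (Suc k)) sums cost f l (f x (h x)) h"
    unfolding cost_def a_def by (simp add: summable_sums)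
  then have "a sums (cost f l (f x (h x)) h + a 0)" by (rule sums_Suc)
  then have "suminf a = ennreal (l x (h x)) + cost f l (f x (h x)) h"
    by (simp add: sums_iff add.commute) (simp add: a_def closed_loop_def)
  then show ?thesis unfolding cost_def[of f l x h] a_def .
qed

text \<open>Telescoping along the closed loop bounds every partial cost by \<open>V x\<close>, the
  leftover value of \<open>V\<close> being nonnegative. In \<open>ennreal\<close>, \<open>V\<close>
  may be infinite.\<close>

lemma cost_le:
  assumes dec: "\<And>x. ennreal (l x (h x)) + V (f x (h x)) \<le> V x"
  shows "cost f l x h \<le> V x"
proof -
  let ?c = "\<lambda>k. closed_loop f k x h"
  have *: "(\<Sum>k<N. ennreal (l (?c k) (h (?c k)))) + V (?c N) \<le> V x" for N
  proof (induction N)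
    case 0
    then show ?case by (simp add: closed_loop_def)
  next
    case (Suc N)
    have "?c (Suc N) = f (?c N) (h (?c N))" by (simp add: closed_loop_def)
    then have "(\<Sum>k<Suc N. ennreal (l (?c k) (h (?c k)))) + V (?c (Suc N))
        \<le> (\<Sum>k<N. ennreal (l (?c k) (h (?c k)))) + V (?c N)"
      using dec[of "?c N"] by (simp add: add.assoc add_left_mono)
    then show ?case using Suc by (rule order_trans)
  qed
  have "(\<Sum>k<N. ennreal (l (?c k) (h (?c k)))) \<le> V x" for N
    using *[of N] by (meson le_iff_add order_trans)
  then show ?thesis unfolding cost_def by (intro suminf_le_const) auto
qed

section \<open>Lower semicontinuity and outer semicontinuous regularization\<close>

text \<open>From here on lower semicontinuity is used in the form of closed sublevel sets. The
  filter \<open>at x\<close> omits \<open>x\<close>, so the point itself is added by hand.\<close>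

lemma lsc_imp_closed_sublevel:
  assumes "lsc V"
  shows "closed {x. V x \<le> c}"
proof -
  have "open {x. c < V x}"
  proof (subst open_subopen, intro ballI)
    fix x assume "x \<in> {x. c < V x}"
    then have x: "c < V x" by simp
    moreover have "V x \<le> Liminf (at x) V" using assms by (simp add: lsc_def)
    ultimately have "eventually (\<lambda>y. c < V y) (at x)"
      by (simp add: le_Liminf_iff)
    then obtain S where "open S" "x \<in> S" "\<And>y. y \<in> S \<Longrightarrow> y \<noteq> x \<Longrightarrow> c < V y"
      unfolding eventually_at_topological by blast
    then show "\<exists>T. open T \<and> x \<in> T \<and> T \<subseteq> {x. c < V x}" using x by blast
  qed
  moreover have "{x. V x \<le> c} = - {x. c < V x}" by auto
  ultimately show ?thesis by (simp add: closed_def)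
qed

text \<open>Once \<open>xs n\<close> is within half of the radius of \<open>x\<close>, the
  half-radius ball around it lies in the ball around \<open>x\<close>, and the closure over the
  latter contains the limit.\<close>

lemma osc_regularize: "osc (regularize S)"
  unfolding osc_def
proof (intro allI impI, elim conjE)
  fix xs us x u
  assume xs: "xs \<longlonglongrightarrow> x" and us: "\<forall>n. us n \<in> regularize S (xs n)" and u: "us \<longlonglongrightarrow> u"
  have "u \<in> closure (\<Union>y\<in>cball x \<delta>. S y)" if "\<delta> > 0" for \<delta>
  proof (rule Lim_in_closed_set[OF closed_closure _ _ u])
    have "eventually (\<lambda>n. dist (xs n) x < \<delta>/2) sequentially"
      using tendstoD[OF xs, of "\<delta>/2"] that by simp
    then show "eventually (\<lambda>n. us n \<in> closure (\<Union>y\<in>cball x \<delta>. S y)) sequentially"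
    proof eventually_elim
      case (elim n)
      have "cball (xs n) (\<delta>/2) \<subseteq> cball x \<delta>"
        using elim by (intro subsetI) (simp add: dist_commute, metric)
      then have "closure (\<Union>y\<in>cball (xs n) (\<delta>/2). S y) \<subseteq> closure (\<Union>y\<in>cball x \<delta>. S y)"
        by (intro closure_mono) blast
      moreover have "us n \<in> closure (\<Union>y\<in>cball (xs n) (\<delta>/2). S y)"
        using us that by (simp add: regularize_def)
      ultimately show ?case by blast
    qed
  qed simp
  then show "u \<in> regularize S x" by (simp add: regularize_def)
qed

lemma subset_regularize: "S x \<subseteq> regularize S x"
proof
  fix u assume u: "u \<in> S x"
  have "u \<in> closure (\<Union>y\<in>cball x \<delta>. S y)" if "\<delta> > 0" for \<delta>
  proof -
    have "x \<in> cball x \<delta>" using that by simp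
    then have "u \<in> (\<Union>y\<in>cball x \<delta>. S y)" using u by blast
    then show ?thesis by (rule subsetD[OF closure_subset])
  qed
  then show "u \<in> regularize S x" by (simp add: regularize_def)
qed

text \<open>A point of the regularization is a limit of values of \<open>S\<close> at points tending
  to \<open>x\<close>, and outer semicontinuity of \<open>U\<close> keeps such limits in
  \<open>U x\<close>. Regularized policies therefore stay admissible.\<close>

lemma regularize_subset:
  fixes S :: "'x::metric_space \<Rightarrow> 'u::metric_space set"
  assumes "osc U" "\<And>x. S x \<subseteq> U x"
  shows "regularize S x \<subseteq> U x"
proof
  fix u assume u: "u \<in> regularize S x"
  have "\<exists>y v. dist y x \<le> 1 / Suc n \<and> v \<in> S y \<and> dist v u < 1 / Suc n" for n
  proof -
    have "u \<in> closure (\<Union>y\<in>cball x (1 / Suc n). S y)"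
      using u by (auto simp: regularize_def)
    then have "\<exists>v\<in>(\<Union>y\<in>cball x (1 / Suc n). S y). dist v u < 1 / Suc n"
      unfolding closure_approachable by (meson zero_less_divide_1_iff of_nat_0_less_iff zero_less_Suc)
    then show ?thesis by (metis UN_E dist_commute mem_cball)
  qed
  then obtain y v where yv: "\<And>n. dist (y n) x \<le> 1 / Suc n" "\<And>n. v n \<in> S (y n)"
      "\<And>n. dist (v n) u < 1 / Suc n"
    by metis
  have lim: "(\<lambda>n. 1 / real (Suc n)) \<longlonglongrightarrow> 0"
    using LIMSEQ_inverse_real_of_nat by (simp add: inverse_eq_divide)
  have "y \<longlonglongrightarrow> x"
    by (rule metric_tendsto_imp_tendsto[OF lim]) (use yv in auto)
  moreover have "v \<longlonglongrightarrow> u"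
    by (rule metric_tendsto_imp_tendsto[OF lim]) (use yv(3) in \<open>auto simp: less_imp_le\<close>)
  moreover have "\<forall>n. v n \<in> U (y n)" using yv(2) assms(2) by blast
  ultimately show "u \<in> U x" using assms(1) unfolding osc_def by blast
qed

section \<open>One-step minimization with a level-bounded stage cost\<close>

locale level_bounded_problem =
  fixes f :: "'x::metric_space \<Rightarrow> 'u::heine_borel \<Rightarrow> 'x"
    and l :: "'x \<Rightarrow> 'u \<Rightarrow> real"
  assumes l_nonneg: "\<And>x u. l x u \<ge> 0"
    and f_cont: "continuous_on UNIV (\<lambda>(x, u). f x u)"
    and l_cont: "continuous_on UNIV (\<lambda>(x, u). l x u)"
    and l_bounded: "level_bounded_loc_unif l"
begin

lemma f_tendsto: "xs \<longlonglongrightarrow> x \<Longrightarrow> us \<longlonglongrightarrow> u \<Longrightarrow> (\<lambda>n. f (xs n) (us n)) \<longlonglongrightarrow> f x u"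
  using continuous_on_tendsto_compose[OF f_cont tendsto_Pair[of xs x sequentially us u]] by simp

lemma l_tendsto: "xs \<longlonglongrightarrow> x \<Longrightarrow> us \<longlonglongrightarrow> u \<Longrightarrow> (\<lambda>n. l (xs n) (us n)) \<longlonglongrightarrow> l x u"
  using continuous_on_tendsto_compose[OF l_cont tendsto_Pair[of xs x sequentially us u]] by simp

text \<open>The state-action value (Q-function) for the continuation value \<open>V\<close>.\<close>

definition one_step :: "('x \<Rightarrow> ennreal) \<Rightarrow> 'x \<Rightarrow> 'u \<Rightarrow> ennreal" where
  "one_step V x u = ennreal (l x u) + V (f x u)"

lemma argmin_map_iff:
  "u \<in> argmin_map f l S V x \<longleftrightarrow> u \<in> S x \<and> (\<forall>v\<in>S x. one_step V x u \<le> one_step V x v)"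
  by (auto simp: argmin_map_def is_arg_min_linorder one_step_def)

text \<open>Up to \<open>e\<close>, the stage cost along the sequence is eventually at least its
  limit, so the successor states lie in one fixed sublevel set of \<open>V\<close>, which is
  closed.\<close>

lemma one_step_le_limit:
  assumes V: "\<And>c. closed {x. V x \<le> c}"
    and xs: "xs \<longlonglongrightarrow> x" and us: "us \<longlonglongrightarrow> u" and le: "\<And>n. one_step V (xs n) (us n) \<le> c"
  shows "one_step V x u \<le> c"
proof (rule ennreal_le_epsilon)
  fix e :: real assume e: "0 < e"
  have "eventually (\<lambda>n. l x u - e < l (xs n) (us n)) sequentially"
    using l_tendsto[OF xs us] e by (intro order_tendstoD) auto
  then have ev: "eventually (\<lambda>n. V (f (xs n) (us n)) + ennreal (l x u) \<le> c + ennreal e) sequentially"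
  proof eventually_elim
    case (elim n)
    have "ennreal (l x u) \<le> ennreal (l (xs n) (us n)) + ennreal e"
      using elim e l_nonneg by (simp flip: ennreal_plus)
    then have "V (f (xs n) (us n)) + ennreal (l x u)
        \<le> V (f (xs n) (us n)) + (ennreal (l (xs n) (us n)) + ennreal e)"
      by (rule add_left_mono)
    also have "\<dots> = one_step V (xs n) (us n) + ennreal e"
      by (simp add: one_step_def ac_simps)
    also have "\<dots> \<le> c + ennreal e" using le by (rule add_right_mono)
    finally show ?case .
  qed
  then obtain n where "V (f (xs n) (us n)) + ennreal (l x u) \<le> c + ennreal e"
    by (auto simp: eventually_sequentially)
  \<comment> \<open>Subtraction in \<open>ennreal\<close> truncates at 0, so membership in the
    sublevel set below gives the claim only together with this bound.\<close>
  then have "ennreal (l x u) \<le> c + ennreal e"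
    by (rule order_trans[rotated]) (rule add_increasing, auto)
  moreover have "f x u \<in> {y. V y \<le> c + ennreal e - ennreal (l x u)}"
  proof (rule Lim_in_closed_set[OF V _ _ f_tendsto[OF xs us]])
    show "eventually (\<lambda>n. f (xs n) (us n) \<in> {y. V y \<le> c + ennreal e - ennreal (l x u)}) sequentially"
      using ev by eventually_elim (simp add: ennreal_le_minus_iff)
  qed simp
  ultimately show "one_step V x u \<le> c + ennreal e"
    by (auto simp: one_step_def ennreal_le_minus_iff add.commute)
qed

text \<open>A finite \<open>c\<close> bounds the stage cost, and local uniformity of
  level-boundedness confines all but finitely many inputs to one bounded set. A constant
  \<open>xs\<close> yields compactness, a varying one closedness of sublevel sets.\<close>

lemma one_step_le_subseq:
  assumes V: "\<And>c. closed {x. V x \<le> c}" and S: "osc S" and c: "c < \<infinity>"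
    and xs: "xs \<longlonglongrightarrow> x" and us: "\<And>n. us n \<in> S (xs n)" "\<And>n. one_step V (xs n) (us n) \<le> c"
  obtains u r where "u \<in> S x" "one_step V x u \<le> c" "strict_mono r" "(us \<circ> r) \<longlonglongrightarrow> u"
proof -
  obtain r0 where r0: "c = ennreal r0" "r0 \<ge> 0" using c by (cases c) auto
  obtain N B where N: "open N" "x \<in> N" and B: "bounded B" "\<And>z. z \<in> N \<Longrightarrow> {u. l z u \<le> r0} \<subseteq> B"
    using l_bounded unfolding level_bounded_loc_unif_def by meson
  obtain n0 where n0: "\<And>n. n \<ge> n0 \<Longrightarrow> xs n \<in> N"
    using topological_tendstoD[OF xs N] by (auto simp: eventually_sequentially)
  have "us n \<in> B" if "n \<ge> n0" for n
  proof -
    have "ennreal (l (xs n) (us n)) \<le> ennreal r0"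
      using us(2)[of n] r0 unfolding one_step_def by (metis le_iff_add order_trans)
    then show ?thesis using B(2)[OF n0[OF that]] r0 by (auto simp: ennreal_le_iff)
  qed
  then have "us n \<in> B \<union> us ` {..<n0}" for n by (cases "n < n0") auto
  then have "range us \<subseteq> B \<union> us ` {..<n0}" by blast
  moreover have "bounded (B \<union> us ` {..<n0})" using B(1) by (simp add: finite_imp_bounded)
  ultimately have "bounded (range us)" using bounded_subset by blast
  then obtain u r where r: "strict_mono r" "(us \<circ> r) \<longlonglongrightarrow> u"
    using bounded_imp_convergent_subsequence by blast
  have x: "(xs \<circ> r) \<longlonglongrightarrow> x" using LIMSEQ_subseq_LIMSEQ[OF xs r(1)] .
  have "u \<in> S x" using S x r(2) us(1) unfolding osc_def by (metis comp_apply)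
  moreover have "one_step V x u \<le> c"
    using one_step_le_limit[OF V x r(2)] us(2) by simp
  ultimately show thesis using r that by blast
qed

lemma compact_one_step_sublevel:
  assumes V: "\<And>c. closed {x. V x \<le> c}" and S: "osc S" and c: "c < \<infinity>"
  shows "compact {u \<in> S x. one_step V x u \<le> c}"
  unfolding compact_def
proof (intro allI impI)
  fix us :: "nat \<Rightarrow> 'u" assume "\<forall>n. us n \<in> {u \<in> S x. one_step V x u \<le> c}"
  then have us: "us n \<in> S x" "one_step V x (us n) \<le> c" for n by auto
  obtain u r where "u \<in> S x" "one_step V x u \<le> c" "strict_mono r" "(us \<circ> r) \<longlonglongrightarrow> u"
    using one_step_le_subseq[OF V S c tendsto_const us] .
  then show "\<exists>u\<in>{u \<in> S x. one_step V x u \<le> c}. \<exists>r. strict_mono r \<and> (us \<circ> r) \<longlonglongrightarrow> u"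
    by blast
qed

text \<open>If the infimum is infinite, every input is a minimizer. Otherwise the sublevel sets
  slightly above the infimum are nonempty, compact and nested, and a common point is a
  minimizer.\<close>

lemma argmin_map_nonempty:
  assumes V: "\<And>c. closed {x. V x \<le> c}" and S: "osc S" "S x \<noteq> {}"
  shows "argmin_map f l S V x \<noteq> {}"
proof -
  define m where "m = (INF u\<in>S x. one_step V x u)"
  have m: "m \<le> one_step V x u" if "u \<in> S x" for u
    unfolding m_def using that by (rule INF_lower)
  show ?thesis
  proof (cases "m = \<infinity>")
    case True
    then have "one_step V x u = \<infinity>" if "u \<in> S x" for u
      using m[OF that] by (simp add: top_unique)
    then show ?thesis using S(2) argmin_map_iff[of _ S V x] by auto
  next
    case False
    define K where "K n = {u \<in> S x. one_step V x u \<le> m + ennreal (1 / Suc n)}" for n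
    have "\<Inter>(range K) \<noteq> {}"
    proof (rule compact_nest)
      fix n
      show "compact (K n)" unfolding K_def
        using False by (intro compact_one_step_sublevel V S) (simp add: less_top)
      have "m < m + ennreal (1 / Suc n)"
        using False by (simp add: ennreal_add_left_cancel_less[of m 0, simplified])
      then show "K n \<noteq> {}" unfolding K_def m_def by (force simp: INF_less_iff)
    next
      fix n k :: nat assume "n \<le> k"
      then have "1 / real (Suc k) \<le> 1 / real (Suc n)" by (simp add: frac_le)
      then have "m + ennreal (1 / Suc k) \<le> m + ennreal (1 / Suc n)"
        by (intro add_left_mono ennreal_leI)
      then show "K k \<subseteq> K n" unfolding K_def by (auto intro: order_trans)
    qed
    then obtain u where u: "\<And>n. u \<in> K n" by blast
    have "one_step V x u \<le> m"
    proof (rule ennreal_le_epsilon)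
      fix e :: real assume "e > 0"
      then obtain n where "1 / Suc n < e" by (meson nat_approx_posE)
      then have "m + ennreal (1 / Suc n) \<le> m + ennreal e"
        by (intro add_left_mono ennreal_leI) simp
      then show "one_step V x u \<le> m + ennreal e"
        using u[of n] unfolding K_def by (simp only: mem_Collect_eq) (meson order_trans)
    qed
    then have "u \<in> argmin_map f l S V x"
      using u m unfolding argmin_map_iff K_def by (auto intro: order_trans)
    then show ?thesis by blast
  qed
qed

text \<open>Since the infimum is attained, a state is in the sublevel set exactly when some single
  input witnesses it, and witnesses along a convergent sequence of states subconverge.\<close>

lemma closed_sublevel_INF_one_step:
  assumes V: "\<And>c. closed {x. V x \<le> c}" and S: "osc S" "\<And>x. S x \<noteq> {}"
  shows "closed {x. (INF u\<in>S x. one_step V x u) \<le> c}"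
proof (cases "c = \<infinity>")
  case False
  have eq: "(INF u\<in>S x. one_step V x u) \<le> c \<longleftrightarrow> (\<exists>u\<in>S x. one_step V x u \<le> c)" for x
  proof
    assume le: "(INF u\<in>S x. one_step V x u) \<le> c"
    obtain u where u: "u \<in> argmin_map f l S V x"
      using argmin_map_nonempty[OF V S] by blast
    then have "one_step V x u \<le> (INF u\<in>S x. one_step V x u)"
      unfolding argmin_map_iff by (intro INF_greatest) blast
    then show "\<exists>u\<in>S x. one_step V x u \<le> c"
      using u le order_trans unfolding argmin_map_iff by blast
  qed (meson INF_lower2)
  show ?thesis
    unfolding closed_sequential_limits eq
  proof (intro allI impI, elim conjE)
    fix xs x
    assume "\<forall>n. xs n \<in> {x. \<exists>u\<in>S x. one_step V x u \<le> c}" and xs: "xs \<longlonglongrightarrow> x"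
    then obtain us where us: "\<And>n. us n \<in> S (xs n)" "\<And>n. one_step V (xs n) (us n) \<le> c"
      unfolding mem_Collect_eq by metis
    have "c < \<infinity>" using False by (simp add: less_top)
    from one_step_le_subseq[OF V S(1) this xs us] show "x \<in> {x. \<exists>u\<in>S x. one_step V x u \<le> c}"
      by blast
  qed
qed simp

section \<open>Value iteration over an outer semicontinuous map\<close>

text \<open>The optimal cost over \<open>n\<close> stages with inputs restricted to \<open>S\<close>
  and zero terminal cost.\<close>

primrec value_iter :: "('x \<Rightarrow> 'u set) \<Rightarrow> nat \<Rightarrow> 'x \<Rightarrow> ennreal" where
  "value_iter S 0 = (\<lambda>x. 0)"
| "value_iter S (Suc n) = (\<lambda>x. INF u\<in>S x. one_step (value_iter S n) x u)"

lemma one_step_mono: "(\<And>x. V x \<le> V' x) \<Longrightarrow> one_step V x u \<le> one_step V' x u"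
  unfolding one_step_def by (intro add_left_mono)

lemma value_iter_Suc_mono: "value_iter S n x \<le> value_iter S (Suc n) x"
proof (induction n arbitrary: x)
  case (Suc n)
  then show ?case unfolding value_iter.simps(2)[of S n] value_iter.simps(2)[of S "Suc n"]
    by (intro INF_mono) (blast intro: one_step_mono)
qed simp

lemma value_iter_mono: "n \<le> k \<Longrightarrow> value_iter S n x \<le> value_iter S k x"
  using lift_Suc_mono_le[of "\<lambda>n. value_iter S n x"] value_iter_Suc_mono by blast

lemma closed_sublevel_value_iter:
  assumes "osc S" "\<And>x. S x \<noteq> {}"
  shows "closed {x. value_iter S n x \<le> c}"
proof (induction n arbitrary: c)
  case (Suc n)
  show ?case unfolding value_iter.simps
    by (rule closed_sublevel_INF_one_step[OF Suc assms])
qed simp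

lemma value_iter_le_cost:
  assumes "\<And>x. h x \<in> S x"
  shows "value_iter S n x \<le> cost f l x h"
proof (induction n arbitrary: x)
  case (Suc n)
  have "value_iter S (Suc n) x \<le> one_step (value_iter S n) x (h x)"
    using assms by (simp add: INF_lower)
  also have "\<dots> \<le> cost f l x h"
    unfolding one_step_def cost_unroll[of f l x h] by (intro add_left_mono Suc)
  finally show ?case .
qed simp

text \<open>At each state the inputs whose one-step values stay below the limit of the iterates form
  nested compact sets; a common point satisfies the Bellman inequality for the limit. Choosing one
  at every state gives a selection whose cost is at most the limit, so the infimum is a minimum,
  attained by one selection for all initial states.\<close>

lemma INF_cost_eq_SUP_value_iter:
  assumes S: "osc S" "\<And>x. S x \<noteq> {}"
  shows "(INF h\<in>{h. selection S h}. cost f l x h) = (SUP n. value_iter S n x)"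
proof (rule antisym)
  let ?v = "\<lambda>x. SUP n. value_iter S n x"
  have "\<exists>u\<in>S x. one_step ?v x u \<le> ?v x" for x
  proof (cases "?v x = \<infinity>")
    case True
    obtain u where "u \<in> S x" using S(2) by blast
    moreover have "one_step ?v x u \<le> ?v x" unfolding True by simp
    ultimately show ?thesis by blast
  next
    case False
    then have fin: "?v x < \<infinity>" by (metis infinity_ennreal_def less_top)
    define K where "K n = {u \<in> S x. one_step (value_iter S n) x u \<le> ?v x}" for n
    have "\<Inter>(range K) \<noteq> {}"
    proof (rule compact_nest)
      fix n
      show "compact (K n)" unfolding K_def
        by (rule compact_one_step_sublevel[OF closed_sublevel_value_iter[OF S] S(1) fin])
      obtain u where u: "u \<in> argmin_map f l S (value_iter S n) x"
        using argmin_map_nonempty[OF closed_sublevel_value_iter[OF S] S] by blast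
      then have "one_step (value_iter S n) x u \<le> value_iter S (Suc n) x"
        unfolding argmin_map_iff by (auto intro: INF_greatest)
      also have "\<dots> \<le> ?v x" by (rule SUP_upper) simp
      finally have "one_step (value_iter S n) x u \<le> ?v x" .
      moreover have "u \<in> S x" using u by (simp add: argmin_map_iff)
      ultimately have "u \<in> K n" unfolding K_def by (intro CollectI conjI)
      then show "K n \<noteq> {}" by blast
    next
      fix n k :: nat assume "n \<le> k"
      then have "one_step (value_iter S n) x u \<le> one_step (value_iter S k) x u" for u
        by (intro one_step_mono value_iter_mono)
      from order_trans[OF this] show "K k \<subseteq> K n"
        unfolding K_def by (intro Collect_mono impI conjI; elim conjE)
    qed
    then obtain u where u: "\<And>n. u \<in> K n" by blast
    have "one_step ?v x u = (SUP n. one_step (value_iter S n) x u)"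
      unfolding one_step_def by (simp add: ennreal_SUP_add_right)
    also have "\<dots> \<le> ?v x" using u unfolding K_def by (intro SUP_least) blast
    finally show ?thesis using u[of 0] unfolding K_def by blast
  qed
  then obtain h where h: "\<And>x. h x \<in> S x" "\<And>x. one_step ?v x (h x) \<le> ?v x" by metis
  have "cost f l x h \<le> ?v x"
    by (rule cost_le) (use h(2) in \<open>simp add: one_step_def\<close>)
  then show "(INF h\<in>{h. selection S h}. cost f l x h) \<le> ?v x"
    using h(1) by (intro INF_lower2[of h]) (auto simp: selection_def)
  show "?v x \<le> (INF h\<in>{h. selection S h}. cost f l x h)"
    using S(2) by (intro SUP_least INF_greatest value_iter_le_cost) (auto simp: selection_def)
qed

lemma closed_sublevel_INF_cost:
  assumes S: "osc S" "\<And>x. S x \<noteq> {}"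
  shows "closed {x. (INF h\<in>{h. selection S h}. cost f l x h) \<le> c}"
proof -
  have "{x. (INF h\<in>{h. selection S h}. cost f l x h) \<le> c} = (\<Inter>n. {x. value_iter S n x \<le> c})"
    by (auto simp: INF_cost_eq_SUP_value_iter[OF S] SUP_le_iff)
  then show ?thesis using closed_sublevel_value_iter[OF S] by auto
qed

section \<open>Bellman inequality and improvement along the policy iteration\<close>

text \<open>Compare \<open>u\<close> with \<open>h x\<close> for an arbitrary selection
  \<open>h\<close>, whose cost from the next state bounds the continuation value. That
  \<open>h x\<close> lies in \<open>S x\<close> uses nonemptiness of \<open>S x\<close>, witnessed
  by \<open>u\<close>.\<close>

lemma one_step_argmin_le_INF_cost:
  assumes u: "u \<in> argmin_map f l S (\<lambda>x. INF h\<in>{h. selection S h}. cost f l x h) x"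
  shows "one_step (\<lambda>x. INF h\<in>{h. selection S h}. cost f l x h) x u
    \<le> (INF h\<in>{h. selection S h}. cost f l x h)" (is "one_step ?V x u \<le> _")
proof (rule INF_greatest)
  fix h assume "h \<in> {h. selection S h}"
  then have sel: "selection S h" by simp
  then have "h x \<in> S x" using u by (auto simp: argmin_map_iff selection_def)
  then have "one_step ?V x u \<le> one_step ?V x (h x)" using u by (auto simp: argmin_map_iff)
  also have "\<dots> \<le> cost f l x h"
    unfolding one_step_def cost_unroll[of f l x h] using sel
    by (intro add_left_mono INF_lower) simp
  finally show "one_step ?V x u \<le> cost f l x h" .
qed

text \<open>The first conjunct makes the next argmin nonempty. The second passes to a greedy policy,
  whose cost is then at most the current value; this gives the improvement behind the third.\<close>

lemma PI_invariant:
  assumes U: "\<And>x. U x \<noteq> {}" "osc U" and h0: "selection U h0" and lsc0: "lsc (PI_V f l U h0 0)"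
  shows "(\<forall>c. closed {x. PI_V f l U h0 i x \<le> c})
    \<and> (\<forall>x. \<exists>u\<in>U x. one_step (PI_V f l U h0 i) x u \<le> PI_V f l U h0 i x)
    \<and> (\<forall>x. PI_V f l U h0 i x \<le> cost f l x h0)"
proof (induction i)
  case 0
  have "one_step (PI_V f l U h0 0) x (h0 x) \<le> PI_V f l U h0 0 x" for x
    by (simp add: one_step_def cost_unroll[of f l x h0, symmetric])
  then show ?case using lsc_imp_closed_sublevel[OF lsc0] h0 U(1) by (auto simp: selection_def)
next
  case (Suc i)
  let ?V = "PI_V f l U h0 i" and ?V' = "PI_V f l U h0 (Suc i)"
  let ?H = "argmin_map f l U ?V"
  let ?R = "regularize ?H"
  have V': "?V' = (\<lambda>x. INF h\<in>{h. selection ?R h}. cost f l x h)" by simp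
  have V: "\<And>c. closed {x. ?V x \<le> c}" using Suc by blast
  have H: "?H x \<noteq> {}" for x by (rule argmin_map_nonempty[OF V U(2) U(1)])
  have R: "osc ?R" "\<And>x. ?R x \<noteq> {}"
    using osc_regularize subset_regularize[of ?H] H by blast+
  have RU: "?R x \<subseteq> U x" for x
    by (rule regularize_subset[OF U(2)]) (auto simp: argmin_map_iff)
  have cl: "closed {x. ?V' x \<le> c}" for c
    unfolding V' by (rule closed_sublevel_INF_cost[OF R])
  have "\<exists>u\<in>U x. one_step ?V' x u \<le> ?V' x" for x
  proof -
    obtain u where u: "u \<in> argmin_map f l ?R ?V' x"
      using argmin_map_nonempty[OF cl R] by blast
    have "one_step ?V' x u \<le> ?V' x" using u unfolding V' by (rule one_step_argmin_le_INF_cost)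
    moreover have "u \<in> U x" using u RU by (auto simp: argmin_map_iff)
    ultimately show ?thesis by blast
  qed
  moreover have "?V' x \<le> cost f l x h0" for x
  proof -
    have "\<forall>x. \<exists>u. u \<in> ?H x" using H by blast
    then obtain h where h: "\<And>x. h x \<in> ?H x" by metis
    have "one_step ?V x (h x) \<le> ?V x" for x
    proof -
      obtain v where v: "v \<in> U x" "one_step ?V x v \<le> ?V x" using Suc by blast
      then show ?thesis using h[of x] unfolding argmin_map_iff by (meson order_trans)
    qed
    then have "cost f l x h \<le> ?V x" by (intro cost_le) (simp add: one_step_def)
    \<comment> \<open>Regularization only enlarges the values of \<open>?H\<close>, so the greedy
      policy remains a candidate in the infimum defining \<open>?V'\<close>.\<close>
    moreover have "selection ?R h" using h subset_regularize[of ?H] by (auto simp: selection_def)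
    ultimately have "?V' x \<le> ?V x" unfolding V' by (intro INF_lower2[of h]) auto
    then show ?thesis using Suc order_trans by blast
  qed
  ultimately show ?case using cl by blast
qed

text \<open>For \<open>i = 0\<close> this is the recursion for the cost of \<open>h0\<close>, with
  equality; for later \<open>i\<close> it is the Bellman inequality over the regularized
  map.\<close>

lemma PI_Hstar_decrease:
  assumes U: "\<And>x. U x \<noteq> {}" "osc U" and h0: "selection U h0"
    and u: "u \<in> PI_Hstar f l U h0 i x"
  shows "u \<in> U x" "ennreal (l x u) + PI_V f l U h0 i (f x u) \<le> PI_V f l U h0 i x"
proof -
  have "u \<in> U x \<and> one_step (PI_V f l U h0 i) x u \<le> PI_V f l U h0 i x"
  proof (cases i)
    case 0
    then show ?thesis using u h0 U(1)
      by (auto simp: one_step_def cost_unroll[of f l x h0, symmetric] selection_def)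
  next
    case (Suc j)
    let ?R = "regularize (argmin_map f l U (PI_V f l U h0 j))"
    have V: "PI_V f l U h0 i = (\<lambda>x. INF h\<in>{h. selection ?R h}. cost f l x h)" using Suc by simp
    have *: "u \<in> argmin_map f l ?R (PI_V f l U h0 i) x" using u Suc by simp
    have "?R x \<subseteq> U x"
      by (rule regularize_subset[OF U(2)]) (auto simp: argmin_map_iff)
    moreover have "one_step (PI_V f l U h0 i) x u \<le> PI_V f l U h0 i x"
      using * unfolding V by (rule one_step_argmin_le_INF_cost)
    ultimately show ?thesis using * by (auto simp: argmin_map_iff)
  qed
  then show "u \<in> U x" "ennreal (l x u) + PI_V f l U h0 i (f x u) \<le> PI_V f l U h0 i x"
    by (auto simp: one_step_def)
qed

end

section \<open>The stability bound, uniform in the iteration index\<close>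

theorem theorem4:
  fixes f :: "real^'n \<Rightarrow> real^'m \<Rightarrow> real^'n"
    and l :: "real^'n \<Rightarrow> real^'m \<Rightarrow> real"
    and U :: "real^'n \<Rightarrow> (real^'m) set"
    and h0 :: "real^'n \<Rightarrow> real^'m"
    and \<sigma> W :: "real^'n \<Rightarrow> real"
    and aW cW bW bV :: "real \<Rightarrow> real"
  assumes U_nonempty: "\<And>x. U x \<noteq> {}"
    and l_nonneg: "\<And>x u. l x u \<ge> 0"
    and sigma_cont: "continuous_on UNIV \<sigma>" and sigma_nonneg: "\<And>x. \<sigma> x \<ge> 0"
    and h0: "selection U h0"
    and SA1: "\<And>x. \<exists>us. admissible f U x us \<and> cost_seq f l x us = opt_value f l U x
                    \<and> opt_value f l U x < \<infinity>"
    and SA2_W: "continuous_on UNIV W" "\<And>x. W x \<ge> 0"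
    and SA2_K: "class_K_inf aW" "class_K_inf cW"
    and SA2_bW: "bW ` {0..} \<subseteq> {0..}" "continuous_on {0..} bW" "mono_on {0..} bW" "bW 0 = 0"
    and SA2_upper: "\<And>x u. u \<in> U x \<Longrightarrow> W x \<le> bW (\<sigma> x)"
    and SA2_decr: "\<And>x u. u \<in> U x \<Longrightarrow> W (f x u) - W x \<le> - aW (\<sigma> x) + cW (l x u)"
    and SA3_K: "class_K_inf bV"
    and SA3: "\<And>x. cost f l x h0 \<le> ennreal (bV (\<sigma> x))"
    and A2_i: "continuous_on UNIV (\<lambda>(x, u). f x u)" "continuous_on UNIV (\<lambda>(x, u). l x u)"
    and A2_ii: "level_bounded_loc_unif l"
    and A2_iii: "osc U"
    and A2_iv: "lsc (PI_V f l U h0 0)"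
    and A2_v: "\<And>\<Delta>. \<Delta> > 0 \<Longrightarrow> compact {x. \<sigma> x \<le> \<Delta>}"
  shows "class_KL (beta aW cW bW bV)
       \<and> (\<forall>i x \<phi> k. inclusion_solution (PI_F f l U h0 i) x \<phi>
            \<longrightarrow> \<sigma> (\<phi> k) \<le> beta aW cW bW bV (\<sigma> x) k)"
proof -
  interpret level_bounded_problem f l
    using l_nonneg A2_i A2_ii by unfold_locales
  interpret detectability_functions aW cW bW bV
    using SA2_K SA3_K SA2_bW by unfold_locales
  \<comment> \<open>Passing to reals loses nothing: every V_r^i is bounded by the initial cost,
    which is finite by (SA3).\<close>
  define v where "v i x = enn2real (PI_V f l U h0 i x)" for i x
  define Y where "Y i x = lyapunov (v i x) (W x)" for i x
  have V_le: "PI_V f l U h0 i x \<le> ennreal (bV (\<sigma> x))" for i x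
    using PI_invariant[OF U_nonempty A2_iii h0 A2_iv, of i] SA3[of x] order_trans by blast
  have V_eq: "PI_V f l U h0 i x = ennreal (v i x)" for i x
    unfolding v_def using le_less_trans[OF V_le ennreal_less_top] by simp
  have v: "0 \<le> v i x" "v i x \<le> bV (\<sigma> x)" for i x
    using V_le[of i x] K_inf_nonneg[OF SA3_K sigma_nonneg[of x]]
    by (simp_all add: v_def enn2real_leI)
  have W_le: "W x \<le> bW (\<sigma> x)" for x
    using SA2_upper U_nonempty[of x] by blast
  have Y_upper: "Y i x \<le> alpha_Y_upper aW cW bW bV (\<sigma> x)" for i x
    unfolding Y_def by (rule lyapunov_upper[OF sigma_nonneg v(1) SA2_W(2) v(2) W_le])
  have step: "alpha_Y_lower aW cW bW (\<sigma> x) \<le> Y i x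
      \<and> Y i (f x u) \<le> Y i x - alpha_Y aW cW bW (\<sigma> x)"
    if "u \<in> PI_Hstar f l U h0 i x" for i x u
  proof -
    note d = PI_Hstar_decrease[OF U_nonempty A2_iii h0 that]
    have vd: "v i (f x u) + l x u \<le> v i x"
      using d(2) v(1) l_nonneg
      by (simp add: V_eq add.commute flip: ennreal_plus)
    have c: "0 \<le> l x u" "l x u \<le> v i x" using vd v(1)[of i "f x u"] l_nonneg[of x u] by auto
    show ?thesis unfolding Y_def
      using lyapunov_lower[OF sigma_nonneg c SA2_W(2) SA2_W(2) SA2_decr[OF d(1)]]
        lyapunov_decrease[OF sigma_nonneg c(1) v(1) vd SA2_W(2) SA2_W(2) W_le SA2_decr[OF d(1)]]
      by blast
  qed
  have small: "\<exists>x. \<sigma> x < s" if s0: "0 < s" for s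
  proof (rule ccontr)
    assume "\<not> (\<exists>x. \<sigma> x < s)"
    then have s: "s \<le> \<sigma> x" for x by (simp add: not_less)
    define d where "d = alpha_Y aW cW bW s"
    \<comment> \<open>The initial state is arbitrary; the dynamics for \<open>i = 0\<close> are
      those of \<open>h0\<close>, so a solution exists for all times.\<close>
    define z where "z k = closed_loop f k (0 :: real^'n) h0" for k
    have "d \<le> alpha_Y aW cW bW (\<sigma> x)" for x
      using mono_onD[OF mono_alpha_Y, of s "\<sigma> x"] s[of x] s0 by (simp add: d_def)
    then have dec: "Y 0 (z (Suc k)) \<le> Y 0 (z k) - d" for k
      using step[of "h0 (z k)" 0 "z k"] by (simp add: z_def closed_loop_def) (smt (verit))
    have "Y 0 (z k) \<le> Y 0 (z 0) - k * d" for k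
    proof (induction k)
      case (Suc k)
      then show ?case using dec[of k] by (simp add: algebra_simps)
    qed simp
    moreover have "0 \<le> Y 0 (z k)" for k
      unfolding Y_def by (rule lyapunov_nonneg[OF v(1) SA2_W(2)])
    moreover obtain k :: nat where "Y 0 (z 0) < k * d"
      using reals_Archimedean3[of d] alpha_Y_pos[OF s0] by (auto simp: d_def)
    ultimately show False by (smt (verit))
  qed
  have large: "\<exists>x. s < \<sigma> x" if "0 < s" for s
  proof (rule ccontr)
    assume "\<not> (\<exists>x. s < \<sigma> x)"
    \<comment> \<open>The whole state space would be compact, yet it is unbounded, an index type
      being nonempty.\<close>
    then have "{x. \<sigma> x \<le> s} = UNIV" by (auto simp: not_less)
    then show False using A2_v[OF that] compact_imp_bounded not_bounded_UNIV by metis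
  qed
  have "alpha_Y aW cW bW s \<le> alpha_Y_upper aW cW bW bV s" if s: "0 \<le> s" for s
  proof (cases "s = 0")
    case True
    then show ?thesis by (simp add: alpha_Y_zero K_inf_zero[OF K_inf_alpha_Y_upper])
  next
    case False
    then have "0 < s" using s by simp
    then obtain x0 x1 where "\<sigma> x0 < s" "s < \<sigma> x1" using small large by blast
    moreover have "connected (range \<sigma>)"
      using sigma_cont by (intro connected_continuous_image) auto
    ultimately have "s \<in> range \<sigma>"
      using connectedD_interval[of "range \<sigma>" "\<sigma> x0" "\<sigma> x1" s] by auto
    then obtain x where x: "s = \<sigma> x" by blast
    \<comment> \<open>The inequality does not mention \<open>i\<close>, so one step at
      \<open>i = 0\<close>, where an input is at hand, suffices.\<close>
    have "h0 x \<in> PI_Hstar f l U h0 0 x" by simp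
    from step[OF this] have "Y 0 (f x (h0 x)) \<le> Y 0 x - alpha_Y aW cW bW s" by (simp add: x)
    moreover have "0 \<le> Y 0 (f x (h0 x))"
      unfolding Y_def by (rule lyapunov_nonneg[OF v(1) SA2_W(2)])
    ultimately show ?thesis using Y_upper[of 0 x] by (simp add: x)
  qed
  note KL = lyapunov_class_KL[OF K_inf_alpha_Y_lower K_inf_alpha_Y_upper continuous_alpha_Y
      mono_alpha_Y alpha_Y_zero alpha_Y_pos this]
  have beta: "beta aW cW bW bV = (\<lambda>s k. inv_nn (alpha_Y_lower aW cW bW)
      (mono_iterate (\<lambda>t. t - alpha_Y aW cW bW (inv_nn (alpha_Y_upper aW cW bW bV) t)) k
        (alpha_Y_upper aW cW bW bV s)))"
    unfolding beta_def[abs_def] alpha_Y_tilde_def ..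
  have "\<sigma> (\<phi> k) \<le> beta aW cW bW bV (\<sigma> x) k"
    if sol: "inclusion_solution (PI_F f l U h0 i) x \<phi>" for i x \<phi> k
  proof -
    have "\<exists>u\<in>PI_Hstar f l U h0 i (\<phi> k). \<phi> (Suc k) = f (\<phi> k) u" for k
      using sol by (auto simp: inclusion_solution_def PI_F_def image_iff)
    then have *: "alpha_Y_lower aW cW bW (\<sigma> (\<phi> k)) \<le> Y i (\<phi> k)"
        "Y i (\<phi> (Suc k)) \<le> Y i (\<phi> k) - alpha_Y aW cW bW (\<sigma> (\<phi> k))" for k
      using step by metis+
    have "\<sigma> (\<phi> k) \<le> beta aW cW bW bV (\<sigma> (\<phi> 0)) k"
      unfolding beta
      by (rule KL(2)[where s = "\<lambda>k. \<sigma> (\<phi> k)" and y = "\<lambda>k. Y i (\<phi> k)"])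
        (use sigma_nonneg * Y_upper in auto)
    then show ?thesis using sol by (simp add: inclusion_solution_def)
  qed
  then show ?thesis using KL(1) unfolding beta by blast
qed

end
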